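(* Let $(X_t)_{t\ge 0}$ be a real-valued (strong) Markov Feller process with càdlàg paths and fixed initial condition $X_0 = x$, under its law $\mathbb{P}^x$ and its natural completed filtration $(\mathcal{F}_t)_{t\ge 0}$. Let $\tau$ be a jump time of $(X_t)_{t\ge 0}$ with $\tau<\infty$ almost surely, and let $(A(t))_{t\ge 0}$ be the compensator of $\tau$ with respect to $(\mathcal{F}_t)_{t\ge 0}$. Then the random variable $A(\tau)$ follows an exponential distribution with parameter $1$, i.e. $\mathbb{P}^x(A(\tau)\le t) = 1-e^{-t}$ for all $t\ge 0$.
   Context: Feller process: a Markov process $(X_t)_{t\ge0}$ with transition semigroup $(P_t)_{t\ge0}$ is Feller if (1) $P_0$ is the identity mapping; (2) for all $f\in\mathcal{C}_0$ (continuous functions $\mathbb{R}\to\mathbb{R}$ vanishing at infinity) and all $t\ge 0$, $P_tf\in\mathcal{C}_0$; (3) for all $f\in\mathcal{C}_0$ and all $x\in\mathbb{R}$, $\lim_{t\downarrow 0}P_tf(x)=f(x)$; where $P_tf(x)=\mathbb{E}(f(X_t+x))$, the expectation in this formula being for the process started at $0$. $\mathbb{P}^x$ denotes the law of the process started at $x$. The natural completed filtration is the filtration generated by $X$, completed with the $\mathbb{P}^x$-null sets. A stopping time is a random variable $\tau$ with values in $[0,\infty]$ such that $\{\tau\le t\}\in\mathcal{F}_t$ for all $t\ge0$. A jump time of $X$ is a stopping time $\tau$ of $(\mathcal{F}_t)_{t\ge0}$ with $\mathbb{P}^x(\tau>0)=1$ such that $X_{\tau}\neq X_{\tau^-}$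 on $\{\tau<\infty\}$, where $X_{\tau^-}=\lim_{t\uparrow\tau}X_t$. By a theorem of P.A. Meyer, such a $\tau$ is totally inaccessible, meaning that $\mathbb{P}^x(\tau=S<\infty)=0$ for every predictable stopping time $S$. A stopping time $S$ is predictable if there are stopping times $S_n\le S_{n+1}$ with $S_n<S$ on $\{S>0\}$ and $S_n\to S$ a.s. Compensator of $\tau$: the unique (up to indistinguishability) increasing, right-continuous, predictable process $(A(t))_{t\ge0}$ with $A(0)=0$ such that $(1_{t\ge\tau}-A(t))_{t\ge0}$ is a martingale for $(\mathcal{F}_t)_{t\ge0}$. It satisfies $A(t)=A(t\wedge\tau)$ and, since $\tau$ is totally inaccessible, $A$ is almost surely continuous. *)

theory Defs
  imports "HOL-Probability.Probability"
begin

text \<open>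
  Processes are indexed by real times; only their values at times \<open>t \<ge> 0\<close> matter. Filtrations are
  indexed by \<^typ>\<open>ennreal\<close>, so that \<^const>\<open>stopping_time\<close> and \<^const>\<open>filtration.pre_sigma\<close>
  cover stopping times with values in \<open>[0,\<infinity>]\<close>. The value of a process \<open>Y\<close> at such a time \<open>\<tau>\<close> is
  \<open>Y (enn2real (\<tau> \<omega>)) \<omega>\<close>, used only where \<open>\<tau> \<omega> < \<infinity>\<close>.
\<close>

text \<open>The null sets of \<^term>\<open>completion M\<close> include all subsets of \<open>M\<close>-null sets.\<close>

definition completed_filtration ::
  "'a measure \<Rightarrow> (real \<Rightarrow> 'a \<Rightarrow> real) \<Rightarrow> ennreal \<Rightarrow> 'a measure" where
  "completed_filtration M X t =
     sigma (space M)
       ({X s -` B \<inter> space M | s B. 0 \<le> s \<and> ennreal s \<le> t \<and> B \<in> sets borel}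
        \<union> null_sets (completion M))"

lemma completed_filtration_gen_Pow:
  "{X s -` B \<inter> space M | s B. 0 \<le> s \<and> ennreal s \<le> t \<and> B \<in> sets borel}
     \<union> null_sets (completion M) \<subseteq> Pow (space M)"
proof -
  have "null_sets (completion M) \<subseteq> Pow (space M)"
    by (metis PowI null_setsD2 sets.sets_into_space space_completion subsetI)
  then show ?thesis by blast
qed

lemma filtration_completed_filtration:
  "filtration (space M) (completed_filtration M X)"
proof
  show "space (completed_filtration M X t) = space M" for t
    unfolding completed_filtration_def
    by (rule space_measure_of[OF completed_filtration_gen_Pow])
  show "sets (completed_filtration M X s) \<subseteq> sets (completed_filtration M X t)" if "s \<le> t" for s t
    unfolding completed_filtration_def sets_measure_of[OF completed_filtration_gen_Pow]
  proof (rule sigma_sets_mono', rule Un_mono[OF _ subset_refl], rule subsetI)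
    fix C assume "C \<in> {X r -` B \<inter> space M | r B. 0 \<le> r \<and> ennreal r \<le> s \<and> B \<in> sets borel}"
    then obtain r B where "C = X r -` B \<inter> space M" "0 \<le> r" "ennreal r \<le> s" "B \<in> sets borel"
      by auto
    with order_trans[OF \<open>ennreal r \<le> s\<close> that]
    show "C \<in> {X r -` B \<inter> space M | r B. 0 \<le> r \<and> ennreal r \<le> t \<and> B \<in> sets borel}"
      by auto
  qed
qed

lemma subalgebra_completed_filtration:
  assumes "\<And>t. 0 \<le> t \<Longrightarrow> X t \<in> borel_measurable M"
  shows "subalgebra (completion M) (completed_filtration M X t)"
  unfolding subalgebra_def
proof
  show "space (completed_filtration M X t) = space (completion M)"
    using filtration.space_F[OF filtration_completed_filtration] by simp
  have "X s -` B \<inter> space M \<in> sets (completion M)" if "0 \<le> s" "B \<in> sets borel" for s B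
    by (rule sets_completionI_sets[OF measurable_sets[OF assms[OF that(1)] that(2)]])
  then have "{X s -` B \<inter> space M | s B. 0 \<le> s \<and> ennreal s \<le> t \<and> B \<in> sets borel}
     \<union> null_sets (completion M) \<subseteq> sets (completion M)"
    by (intro Un_least subsetI) (blast, rule null_setsD2)
  then show "sets (completed_filtration M X t) \<subseteq> sets (completion M)"
    unfolding completed_filtration_def sets_measure_of[OF completed_filtration_gen_Pow]
    by (rule sets.sigma_sets_subset[of _ "completion M", unfolded space_completion])
qed

definition transition_op ::
  "(real \<Rightarrow> 'a measure) \<Rightarrow> (real \<Rightarrow> 'a \<Rightarrow> real) \<Rightarrow> real \<Rightarrow> (real \<Rightarrow> real) \<Rightarrow> real \<Rightarrow> real" where
  "transition_op P X t f y = (\<integral>\<omega>. f (X t \<omega>) \<partial>P y)"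

text \<open>
  If the process started at \<open>y\<close> has the law of the process started at \<open>0\<close> shifted by \<open>y\<close>, then
  \<open>P\<^sub>t f(y) = E\<^sup>0 f(X\<^sub>t + y)\<close>.
\<close>

lemma transition_op_shift:
  assumes "X t \<in> borel_measurable (P y)" "X t \<in> borel_measurable (P 0)"
    and "f \<in> borel_measurable borel"
    and "distr (P y) borel (X t) = distr (P 0) borel (\<lambda>\<omega>. X t \<omega> + y)"
  shows "transition_op P X t f y = (\<integral>\<omega>. f (X t \<omega> + y) \<partial>P 0)"
proof -
  have "transition_op P X t f y = (\<integral>z. f z \<partial>distr (P y) borel (X t))"
    unfolding transition_op_def using assms(1,3) by (subst integral_distr) auto
  also have "\<dots> = (\<integral>\<omega>. f (X t \<omega> + y) \<partial>P 0)"
    unfolding assms(4) using assms(2,3) by (subst integral_distr) auto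
  finally show ?thesis .
qed

text \<open>\<open>P y\<close> is the law of the process started at \<open>y\<close>.\<close>

locale markov_process =
  fixes P :: "real \<Rightarrow> 'a measure" and X :: "real \<Rightarrow> 'a \<Rightarrow> real"
  assumes prob_space_P: "\<And>y. prob_space (P y)"
    and sets_P: "\<And>y z. sets (P y) = sets (P z)"
    and measurable_X: "\<And>y t. 0 \<le> t \<Longrightarrow> X t \<in> borel_measurable (P y)"
    and start: "\<And>y. AE \<omega> in P y. X 0 \<omega> = y"
    and markov: "\<And>y s t f. \<lbrakk>0 \<le> s; 0 \<le> t; f \<in> borel_measurable borel; bounded (range f)\<rbrakk> \<Longrightarrow>
      AE \<omega> in completion (P y).
        real_cond_exp (completion (P y)) (completed_filtration (P y) X (ennreal s))
          (\<lambda>\<omega>. f (X (s + t) \<omega>)) \<omega>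
        = transition_op P X t f (X s \<omega>)"

locale strong_markov_process = markov_process +
  assumes strong_markov:
    "\<And>y T t f. \<lbrakk>stopping_time (completed_filtration (P y) X) T; 0 \<le> t;
        f \<in> borel_measurable borel; bounded (range f)\<rbrakk> \<Longrightarrow>
      AE \<omega> in completion (P y).
        real_cond_exp (completion (P y))
          (filtration.pre_sigma (space (P y)) (completed_filtration (P y) X) T)
          (\<lambda>\<omega>. if T \<omega> < \<infinity> then f (X (enn2real (T \<omega>) + t) \<omega>) else 0) \<omega>
        = (if T \<omega> < \<infinity> then transition_op P X t f (X (enn2real (T \<omega>)) \<omega>) else 0)"

definition C0 :: "(real \<Rightarrow> real) set" where
  "C0 = {f. continuous_on UNIV f \<and> (f \<longlongrightarrow> 0) at_infinity}"

locale feller_process = markov_process +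
  assumes feller_id: "\<And>f. f \<in> C0 \<Longrightarrow> transition_op P X 0 f = f"
    and feller_C0: "\<And>f t. \<lbrakk>f \<in> C0; 0 \<le> t\<rbrakk> \<Longrightarrow> transition_op P X t f \<in> C0"
    and feller_lim: "\<And>f y. f \<in> C0 \<Longrightarrow>
      ((\<lambda>t. transition_op P X t f y) \<longlongrightarrow> f y) (at_right 0)"

definition cadlag :: "(real \<Rightarrow> real) \<Rightarrow> bool" where
  "cadlag g \<longleftrightarrow> (\<forall>t\<ge>0. continuous (at_right t) g) \<and> (\<forall>t>0. \<exists>l. (g \<longlongrightarrow> l) (at_left t))"


definition jump_time ::
  "'a measure \<Rightarrow> (ennreal \<Rightarrow> 'a measure) \<Rightarrow> (real \<Rightarrow> 'a \<Rightarrow> real) \<Rightarrow> ('a \<Rightarrow> ennreal) \<Rightarrow> bool" where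
  "jump_time M F X \<tau> \<longleftrightarrow>
     stopping_time F \<tau> \<and>
     (AE \<omega> in M. 0 < \<tau> \<omega>) \<and>
     (AE \<omega> in M. \<tau> \<omega> < \<infinity> \<longrightarrow>
        X (enn2real (\<tau> \<omega>)) \<omega> \<noteq> Lim (at_left (enn2real (\<tau> \<omega>))) (\<lambda>t. X t \<omega>))"

definition is_martingale ::
  "'a measure \<Rightarrow> (ennreal \<Rightarrow> 'a measure) \<Rightarrow> (real \<Rightarrow> 'a \<Rightarrow> real) \<Rightarrow> bool" where
  "is_martingale M F Y \<longleftrightarrow>
     (\<forall>t\<ge>0. Y t \<in> borel_measurable (F (ennreal t)) \<and> integrable M (Y t)) \<and>
     (\<forall>s t. 0 \<le> s \<and> s \<le> t \<longrightarrow>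
        (AE \<omega> in M. real_cond_exp M (F (ennreal s)) (Y t) \<omega> = Y s \<omega>))"

definition predictable_sigma ::
  "'a set \<Rightarrow> (ennreal \<Rightarrow> 'a measure) \<Rightarrow> (real \<times> 'a) measure" where
  "predictable_sigma \<Omega> F =
     sigma ({0..} \<times> \<Omega>)
       ({{0} \<times> B | B. B \<in> sets (F 0)}
        \<union> {{s<..t} \<times> B | s t B. 0 \<le> s \<and> s \<le> t \<and> B \<in> sets (F (ennreal s))})"

definition predictable_process ::
  "'a set \<Rightarrow> (ennreal \<Rightarrow> 'a measure) \<Rightarrow> (real \<Rightarrow> 'a \<Rightarrow> real) \<Rightarrow> bool" where
  "predictable_process \<Omega> F Y \<longleftrightarrow> (\<lambda>(t, \<omega>). Y t \<omega>) \<in> borel_measurable (predictable_sigma \<Omega> F)"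

text \<open>
  Path properties are required almost surely, since compensators are only determined up to
  indistinguishability.
\<close>

definition compensator ::
  "'a measure \<Rightarrow> (ennreal \<Rightarrow> 'a measure) \<Rightarrow> ('a \<Rightarrow> ennreal) \<Rightarrow> (real \<Rightarrow> 'a \<Rightarrow> real) \<Rightarrow> bool" where
  "compensator M F \<tau> A \<longleftrightarrow>
     (AE \<omega> in M. A 0 \<omega> = 0 \<and> mono_on {0..} (\<lambda>t. A t \<omega>) \<and>
        (\<forall>t\<ge>0. continuous (at_right t) (\<lambda>t. A t \<omega>))) \<and>
     predictable_process (space M) F A \<and>
     is_martingale M F (\<lambda>t \<omega>. (if \<tau> \<omega> \<le> ennreal t then 1 else 0) - A t \<omega>)"

end

theory Submission
  imports Defs
begin

text \<open>
  Let \<open>\<mu>\<close> be the law of \<open>(\<tau>, \<omega>)\<close> and \<open>\<nu>\<close> the image of \<open>P\<^sup>x \<otimes> Lebesgue\<close> on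
  \<open>{(\<omega>, u). 0 < u \<le> A\<^sub>\<infinity>(\<omega>)}\<close> under \<open>(\<omega>, u) \<mapsto> (inf {t. A t \<omega> \<ge> u}, \<omega>)\<close>. The martingale property says
  that \<open>\<mu>\<close> and \<open>\<nu>\<close> agree on predictable rectangles, hence on all predictable sets. Where \<open>A\<close> has no jump,
  \<open>A\<close> evaluated at \<open>inf {t. A t \<omega> \<ge> u}\<close> is \<open>u\<close>, so testing \<open>\<mu> = \<nu>\<close> on \<open>f (A t) \<cdot> 1\<^sub>t\<^sub>\<le>\<^sub>\<tau>\<close> gives
  \<open>E f(A(\<tau>)) = E \<integral>\<^sub>0\<^sup>A\<^sup>(\<^sup>\<tau>\<^sup>) f(u) du\<close> for all \<open>f \<ge> 0\<close>, and \<open>f(u) = exp (u - c) \<cdot> 1\<^sub>u\<^sub>\<le>\<^sub>c\<close> yields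
  \<open>P(A(\<tau>) > c) = exp (- c)\<close>.

  Since \<open>\<mu> = \<nu>\<close>, it suffices that \<open>A\<close> does not jump at \<open>\<tau>\<close>. The set where \<open>A\<close> jumps by at least \<open>\<epsilon>\<close> is
  predictable, so up to small \<open>\<mu>\<close>-measure it is the zero set of a continuous adapted process. Its
  points are isolated from the left, hence are first zeros of countably many such processes. A first
  zero \<open>S\<close> is announced by the hitting times of \<open>[0, 1/n]\<close>, so the strong Markov and Feller properties give
  \<open>X\<^sub>S = X\<^sub>S\<^sub>-\<close> almost surely, whereas \<open>X\<close> jumps at \<open>\<tau>\<close>.
\<close>

section \<open>Hitting times of continuous adapted processes\<close>

text \<open>\<open>T\<close> is approximated from the right by times with values in a countable
  grid, where sampling is measurable one grid point at a time; right-continuity then passes to the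
  limit.\<close>

lemma measurable_sample_right_continuous:
  fixes Z :: "real \<Rightarrow> 'a \<Rightarrow> real"
  assumes Z: "\<And>t. 0 \<le> t \<Longrightarrow> Z t \<in> borel_measurable M"
    and cont: "\<And>\<omega> t. \<omega> \<in> space M \<Longrightarrow> 0 \<le> t \<Longrightarrow> continuous (at_right t) (\<lambda>t. Z t \<omega>)"
    and T[measurable]: "T \<in> borel_measurable M"
    and T0: "\<And>\<omega>. \<omega> \<in> space M \<Longrightarrow> 0 \<le> T \<omega>"
  shows "(\<lambda>\<omega>. Z (T \<omega>) \<omega>) \<in> borel_measurable M"
proof (rule borel_measurable_LIMSEQ_real)
  \<comment> \<open>The \<open>+ 1\<close> puts the grid point strictly above \<open>T\<close>, as
    the filter \<open>at_right\<close> demands, and \<open>max 0\<close> keeps it among the times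
    where \<open>Z\<close> is measurable, whatever the integer \<open>i\<close>.\<close>
  define r where "r n i = max 0 ((of_int i + 1) / real (Suc n))" for n i
  define k where "k n \<omega> = \<lfloor>T \<omega> * real (Suc n)\<rfloor>" for n \<omega>
  have k[measurable]: "k n \<in> measurable M (count_space UNIV)" for n
    unfolding k_def by measurable
  show "(\<lambda>\<omega>. Z (r n (k n \<omega>)) \<omega>) \<in> borel_measurable M" for n
    by (rule measurable_compose_countable[OF _ k]) (rule Z, simp add: r_def)
  fix \<omega> assume w: "\<omega> \<in> space M"
  have gt: "T \<omega> < r n (k n \<omega>)" and le: "r n (k n \<omega>) \<le> T \<omega> + 1 / real (Suc n)" for n
  proof -
    have "T \<omega> * real (Suc n) < of_int (k n \<omega>) + 1" unfolding k_def by linarith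
    then have "T \<omega> < (of_int (k n \<omega>) + 1) / real (Suc n)" by (simp add: field_simps)
    then show "T \<omega> < r n (k n \<omega>)" unfolding r_def by linarith
    have "of_int (k n \<omega>) \<le> T \<omega> * real (Suc n)" unfolding k_def by linarith
    then have "of_int (k n \<omega>) / real (Suc n) \<le> T \<omega>" by (simp add: divide_le_eq)
    then have "(of_int (k n \<omega>) + 1) / real (Suc n) \<le> T \<omega> + 1 / real (Suc n)"
      by (simp add: add_divide_distrib)
    then show "r n (k n \<omega>) \<le> T \<omega> + 1 / real (Suc n)"
      unfolding r_def using T0[OF w] by (simp add: add_nonneg_nonneg)
  qed
  have lim: "(\<lambda>n. T \<omega> + 1 / real (Suc n)) \<longlonglongrightarrow> T \<omega> + 0"
    by (intro tendsto_intros LIMSEQ_Suc lim_1_over_n)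
  have "(\<lambda>n. r n (k n \<omega>)) \<longlonglongrightarrow> T \<omega>"
  proof (rule tendsto_sandwich)
    show "(\<lambda>n. T \<omega>) \<longlonglongrightarrow> T \<omega>" by simp
    show "\<forall>\<^sub>F n in sequentially. T \<omega> \<le> r n (k n \<omega>)" by (simp add: less_imp_le[OF gt])
    show "\<forall>\<^sub>F n in sequentially. r n (k n \<omega>) \<le> T \<omega> + 1 / real (Suc n)"
      by (intro always_eventually allI le)
    show "(\<lambda>n. T \<omega> + 1 / real (Suc n)) \<longlonglongrightarrow> T \<omega>" using lim by simp
  qed
  then have fr: "filterlim (\<lambda>n. r n (k n \<omega>)) (at_right (T \<omega>)) sequentially"
    unfolding filterlim_at by (simp add: gt less_imp_neq[OF gt, symmetric])
  have "((\<lambda>t. Z t \<omega>) \<longlongrightarrow> Z (T \<omega>) \<omega>) (at_right (T \<omega>))"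
    using cont[OF w T0[OF w]] by (simp add: continuous_within)
  from filterlim_compose[OF this fr]
  show "(\<lambda>n. Z (r n (k n \<omega>)) \<omega>) \<longlonglongrightarrow> Z (T \<omega>) \<omega>" .
qed

locale filtered_prob_space = prob_space M + filtration "space M" F
  for M :: "'a measure" and F :: "ennreal \<Rightarrow> 'a measure" +
  assumes F_le: "\<And>t. sets (F t) \<subseteq> sets M"
begin

text \<open>Nonnegativity lets zero sets be combined: a finite product vanishes on the union, and a
  weighted sum vanishes exactly on the intersection.\<close>

definition cont_adapted :: "(real \<Rightarrow> 'a \<Rightarrow> real) \<Rightarrow> bool" where
  "cont_adapted Y \<longleftrightarrow> (\<forall>t\<ge>0. Y t \<in> borel_measurable (F (ennreal t))) \<and>
     (\<forall>\<omega>\<in>space M. continuous_on {0..} (\<lambda>t. Y t \<omega>) \<and> (\<forall>t\<ge>0. 0 \<le> Y t \<omega>))"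

text \<open>A real infimum is a hitting time only if the level is reached. The context below
  guarantees this by a deterministic time \<open>b\<close> at which every path of \<open>Y\<close>
  is zero.\<close>

definition hit :: "(real \<Rightarrow> 'a \<Rightarrow> real) \<Rightarrow> real \<Rightarrow> 'a \<Rightarrow> real" where
  "hit Y c \<omega> = Inf {t. 0 \<le> t \<and> Y t \<omega> \<le> c}"

lemma measurable_F_mono: "s \<le> t \<Longrightarrow> f \<in> measurable (F s) N \<Longrightarrow> f \<in> measurable (F t) N"
  unfolding measurable_def space_F using sets_F_mono[of s t] by blast

lemma measurable_F_M: "f \<in> measurable (F s) N \<Longrightarrow> f \<in> measurable M N"
  unfolding measurable_def space_F using F_le[of s] by blast

lemma cont_adapted_measurable:
  assumes "cont_adapted Y" "0 \<le> s" "s \<le> t"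
  shows "Y s \<in> borel_measurable (F (ennreal t))"
proof (rule measurable_F_mono[OF ennreal_leI[OF assms(3)]])
  show "Y s \<in> borel_measurable (F (ennreal s))"
    using assms(1,2) unfolding cont_adapted_def by blast
qed

context
  fixes Y :: "real \<Rightarrow> 'a \<Rightarrow> real" and b :: real
  assumes Y: "cont_adapted Y" and b: "0 \<le> b" and Yb: "\<And>\<omega>. \<omega> \<in> space M \<Longrightarrow> Y b \<omega> = 0"
begin

text \<open>Since the path is continuous, the times at which it is at most \<open>c\<close> form a
  closed set, which contains its infimum.\<close>

lemma hit_attained:
  assumes w: "\<omega> \<in> space M" and c: "0 \<le> c"
  shows "0 \<le> hit Y c \<omega>" "hit Y c \<omega> \<le> b" "Y (hit Y c \<omega>) \<omega> \<le> c"
    "\<And>t. 0 \<le> t \<Longrightarrow> Y t \<omega> \<le> c \<Longrightarrow> hit Y c \<omega> \<le> t"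
proof -
  let ?S = "{t. 0 \<le> t \<and> Y t \<omega> \<le> c}"
  have ne: "?S \<noteq> {}" using b Yb[OF w] c by auto
  have bd: "bdd_below ?S" by (rule bdd_belowI[of _ 0]) auto
  have "continuous_on {0..} (\<lambda>t. Y t \<omega>)" using Y w by (auto simp: cont_adapted_def)
  then have "closed ({0..} \<inter> (\<lambda>t. Y t \<omega>) -` {..c})"
    by (intro continuous_closed_preimage) auto
  also have "{0..} \<inter> (\<lambda>t. Y t \<omega>) -` {..c} = ?S" by auto
  finally have "Inf ?S \<in> ?S" by (rule closed_contains_Inf[OF ne bd])
  then show "0 \<le> hit Y c \<omega>" "Y (hit Y c \<omega>) \<omega> \<le> c" by (auto simp: hit_def)
  show l: "\<And>t. 0 \<le> t \<Longrightarrow> Y t \<omega> \<le> c \<Longrightarrow> hit Y c \<omega> \<le> t"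
    unfolding hit_def by (rule cInf_lower[OF _ bd]) auto
  show "hit Y c \<omega> \<le> b" using b Yb[OF w] c by (intro l) auto
qed

lemma hit_zero:
  assumes w: "\<omega> \<in> space M" shows "Y (hit Y 0 \<omega>) \<omega> = 0"
proof (rule antisym)
  show "Y (hit Y 0 \<omega>) \<omega> \<le> 0" by (rule hit_attained(3)[OF w order_refl])
  show "0 \<le> Y (hit Y 0 \<omega>) \<omega>"
    using Y w hit_attained(1)[OF w order_refl] by (auto simp: cont_adapted_def)
qed

lemma hit_antimono:
  assumes w: "\<omega> \<in> space M" and c: "0 \<le> c" "c \<le> d"
  shows "hit Y d \<omega> \<le> hit Y c \<omega>"
  by (rule hit_attained(4)[OF w order_trans[OF c] hit_attained(1)[OF w c(1)]
    order_trans[OF hit_attained(3)[OF w c(1)] c(2)]])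

text \<open>By continuity the path is already below \<open>c\<close> shortly before its first zero.
  With \<open>hit_antimono\<close> and \<open>hit_tendsto\<close> this says that the hitting times
  of small levels announce the first zero, which is therefore predictable.\<close>

lemma hit_less:
  assumes w: "\<omega> \<in> space M" and c: "0 < c" and pos: "0 < hit Y 0 \<omega>"
  shows "hit Y c \<omega> < hit Y 0 \<omega>"
proof -
  let ?s = "hit Y 0 \<omega>"
  have co: "continuous_on {0..} (\<lambda>t. Y t \<omega>)" using Y w by (auto simp: cont_adapted_def)
  have "isCont (\<lambda>t. Y t \<omega>) ?s"
    by (rule continuous_on_interior[OF co]) (use pos in simp)
  then have "((\<lambda>t. Y t \<omega>) \<longlongrightarrow> 0) (at_left ?s)"
    using hit_zero[OF w] by (metis filterlim_at_split isCont_def)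
  then have "eventually (\<lambda>t. Y t \<omega> < c) (at_left ?s)"
    using c by (rule order_tendstoD)
  moreover have "eventually (\<lambda>t. t \<in> {0<..<?s}) (at_left ?s)"
    using pos by (rule eventually_at_leftI[rotated]) auto
  ultimately have "eventually (\<lambda>t. Y t \<omega> < c \<and> t \<in> {0<..<?s}) (at_left ?s)"
    by eventually_elim auto
  then obtain t where t: "Y t \<omega> < c" "0 < t" "t < ?s"
    using eventually_happens[of _ "at_left ?s"] trivial_limit_at_left_real by auto
  then show ?thesis using hit_attained(4)[OF w, of c t] c by auto
qed

text \<open>The hitting times increase and are bounded by \<open>b\<close>, so they have a limit
  \<open>l\<close>. Continuity gives \<open>Y l \<omega> \<le> 0\<close>, hence the first zero is at
  most \<open>l\<close>.\<close>

lemma hit_tendsto: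
  assumes w: "\<omega> \<in> space M"
  shows "(\<lambda>n. hit Y (1 / real (Suc n)) \<omega>) \<longlonglongrightarrow> hit Y 0 \<omega>"
proof -
  let ?h = "\<lambda>n. hit Y (1 / real (Suc n)) \<omega>"
  have inc: "incseq ?h"
    by (intro incseq_SucI hit_antimono w) (auto simp: field_simps)
  have "?h n \<le> b" for n by (intro hit_attained w) auto
  then obtain l where l: "?h \<longlonglongrightarrow> l" "\<And>n. ?h n \<le> l"
    using incseq_convergent[OF inc] by blast
  have h0: "0 \<le> ?h n" for n by (intro hit_attained w) auto
  have l0: "0 \<le> l" using h0[of 0] l(2)[of 0] by linarith
  have "continuous_on {0..} (\<lambda>t. Y t \<omega>)" using Y w by (auto simp: cont_adapted_def)
  then have "(\<lambda>n. Y (?h n) \<omega>) \<longlonglongrightarrow> Y l \<omega>"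
    by (rule continuous_on_tendsto_compose[OF _ l(1)]) (use l0 h0 in auto)
  moreover have "(\<lambda>n. 1 / real (Suc n)) \<longlonglongrightarrow> 0" by (intro LIMSEQ_Suc lim_1_over_n)
  moreover have "Y (?h n) \<omega> \<le> 1 / real (Suc n)" for n by (intro hit_attained w) auto
  ultimately have "Y l \<omega> \<le> 0" by (intro LIMSEQ_le) auto
  then have "hit Y 0 \<omega> \<le> l" by (intro hit_attained w l0) auto
  moreover have "l \<le> hit Y 0 \<omega>"
    by (rule LIMSEQ_le_const2[OF l(1)]) (auto intro!: hit_antimono w)
  ultimately show ?thesis using l(1) by simp
qed

text \<open>By continuity on the compact interval from 0 to \<open>r\<close>, the level
  \<open>c\<close> is reached by time \<open>r\<close> iff for each \<open>n\<close> there is a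
  value below \<open>c + 1 / (n + 1)\<close> at some time \<open>r * q\<close> with \<open>q\<close>
  a rational fraction. The fractions give one countable index set for all \<open>r\<close>.\<close>

lemma stopping_time_hit:
  assumes c: "0 \<le> c"
  shows "stopping_time F (\<lambda>\<omega>. ennreal (hit Y c \<omega>))"
proof (rule stopping_timeI)
  fix t :: ennreal
  show "Measurable.pred (F t) (\<lambda>\<omega>. ennreal (hit Y c \<omega>) \<le> t)"
  proof (cases t)
    case top
    then show ?thesis by simp
  next
    case (real r)
    have eq: "ennreal (hit Y c \<omega>) \<le> t \<longleftrightarrow>
       (\<forall>n. \<exists>q\<in>\<rat> \<inter> {0..1}. Y (r * q) \<omega> < c + 1 / real (Suc n))" (is "_ \<longleftrightarrow> ?R")
      if "\<omega> \<in> space (F t)" for \<omega>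
    proof -
      have w: "\<omega> \<in> space M" using that by (simp add: space_F)
      have co: "continuous_on {0..} (\<lambda>t. Y t \<omega>)" using Y w by (auto simp: cont_adapted_def)
      have "(ennreal (hit Y c \<omega>) \<le> t) = (hit Y c \<omega> \<le> r)"
        using real hit_attained(1)[OF w c] by simp
      also have "\<dots> = ?R"
      proof
        assume le: "hit Y c \<omega> \<le> r"
        let ?h = "hit Y c \<omega>"
        show ?R
        proof
          fix n
          let ?d = "c + 1 / real (Suc n)"
          have Yh: "Y ?h \<omega> < ?d" using hit_attained(3)[OF w c] by (smt (verit) of_nat_0_less_iff zero_less_Suc divide_pos_pos)
          show "\<exists>q\<in>\<rat> \<inter> {0..1}. Y (r * q) \<omega> < ?d"
          proof (cases "r = 0")
            case True
            then have "?h = 0" using le hit_attained(1)[OF w c] by simp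
            then show ?thesis using Yh True by (intro bexI[of _ 0]) auto
          next
            case False
            then have r: "0 < r" using real by simp
            define p where "p = ?h / r"
            have p: "0 \<le> p" "p \<le> 1" "r * p = ?h" using le r hit_attained(1)[OF w c] by (auto simp: p_def)
            have "continuous_on {0..1} (\<lambda>q. Y (r * q) \<omega>)"
              by (intro continuous_on_compose2[OF co] continuous_intros) (use r in auto)
            then have "openin (top_of_set {0..1}) ({0..1} \<inter> (\<lambda>q. Y (r * q) \<omega>) -` {..<?d})"
              by (rule continuous_openin_preimage_gen) auto
            then obtain U where U: "open U" "{0..1} \<inter> (\<lambda>q. Y (r * q) \<omega>) -` {..<?d} = {0..1} \<inter> U"
              by (auto simp: openin_open)
            have "p \<in> {0..1} \<inter> (\<lambda>q. Y (r * q) \<omega>) -` {..<?d}" using p Yh by simp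
            then have "p \<in> U" unfolding U(2) by simp
            then obtain e where e: "0 < e" "ball p e \<subseteq> U" using U(1) openE by blast
            have "max 0 (p - e) < min 1 (p + e)" using p e by auto
            then obtain q where q: "q \<in> \<rat>" "max 0 (p - e) < q" "q < min 1 (p + e)"
              using Rats_dense_in_real by blast
            then have "q \<in> {0..1} \<inter> U" using e(2) by (auto simp: dist_real_def subset_iff)
            then have "q \<in> {0..1}" "Y (r * q) \<omega> < ?d" unfolding U(2)[symmetric] by simp_all
            then show ?thesis using q(1) by (intro bexI[of _ q]) simp_all
          qed
        qed
      next
        assume R: ?R
        then have "\<forall>n. \<exists>q. q \<in> {0..1} \<and> Y (r * q) \<omega> < c + 1 / real (Suc n)" by blast
        then obtain q where q: "\<And>n. q n \<in> {0..1}" "\<And>n. Y (r * q n) \<omega> < c + 1 / real (Suc n)"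
          by metis
        \<comment> \<open>The fractions \<open>q n\<close>, whose values are below
          \<open>c + 1 / (n + 1)\<close>, accumulate at some \<open>l\<close>; at time
          \<open>r * l\<close> the path is at most \<open>c\<close>.\<close>
        have "compact {0..1::real}" by simp
        then obtain l s where l: "l \<in> {0..1}" "strict_mono s" "(q \<circ> s) \<longlonglongrightarrow> l"
          using q(1) unfolding compact_def by blast
        have "(\<lambda>n. Y (r * (q \<circ> s) n) \<omega>) \<longlonglongrightarrow> Y (r * l) \<omega>"
        proof (rule continuous_on_tendsto_compose[OF co])
          show "(\<lambda>n. r * (q \<circ> s) n) \<longlonglongrightarrow> r * l" by (intro tendsto_intros l(3))
          show "r * l \<in> {0..}" using l(1) real by simp
          show "\<forall>\<^sub>F n in sequentially. r * (q \<circ> s) n \<in> {0..}"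
            using q(1) real by (intro always_eventually) (simp add: mult_nonneg_nonneg)
        qed
        moreover have "(\<lambda>n. c + 1 / real (Suc (s n))) \<longlonglongrightarrow> c + 0"
          by (intro tendsto_intros LIMSEQ_subseq_LIMSEQ[OF LIMSEQ_Suc[OF lim_1_over_n] l(2), unfolded comp_def])
        ultimately have "Y (r * l) \<omega> \<le> c + 0"
          by (rule LIMSEQ_le) (intro exI[of _ 0] allI impI less_imp_le, simp add: q(2) del: of_nat_Suc)
        then have "hit Y c \<omega> \<le> r * l" using l(1) real by (intro hit_attained w c) auto
        also have "\<dots> \<le> r" using l(1) real by (simp add: mult_left_le)
        finally show "hit Y c \<omega> \<le> r" .
      qed
      finally show ?thesis .
    qed
    have 1: "Measurable.pred (F t) (\<lambda>\<omega>. Y (r * q) \<omega> < c + 1 / real (Suc n))"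
      if "q \<in> \<rat> \<inter> {0..1}" for q n
    proof -
      have [measurable]: "Y (r * q) \<in> borel_measurable (F t)"
        unfolding real using that real(1)
        by (intro cont_adapted_measurable[OF Y]) (simp_all add: mult_left_le mult_nonneg_nonneg)
      show ?thesis by measurable
    qed
    have "countable (\<rat> \<inter> {0..1::real})" by (simp add: countable_Int1 countable_rat)
    then have "Measurable.pred (F t) (\<lambda>\<omega>. \<forall>n. \<exists>q\<in>\<rat> \<inter> {0..1}. Y (r * q) \<omega> < c + 1 / real (Suc n))"
      by (intro pred_intros_countable(1) measurable_pred_countable(2) 1)
    then show ?thesis by (subst measurable_cong[OF eq])
  qed
qed

end

end

section \<open>Inner regularity of predictable sets\<close>

context filtered_prob_space begin

definition zeros :: "(real \<Rightarrow> 'a \<Rightarrow> real) \<Rightarrow> (real \<times> 'a) set" where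
  "zeros Y = {(t, \<omega>). 0 \<le> t \<and> \<omega> \<in> space M \<and> Y t \<omega> = 0}"

definition graph_event :: "('a \<Rightarrow> real) \<Rightarrow> (real \<times> 'a) set \<Rightarrow> 'a set" where
  "graph_event T D = {\<omega> \<in> space M. (T \<omega>, \<omega>) \<in> D}"

text \<open>Inner regularity for the law of the pair of \<open>T\<close> and the sample point. Zero
  sets of continuous adapted processes take the place that closed sets have for Borel measures on a
  metric space.\<close>

definition inner_regular_at :: "('a \<Rightarrow> real) \<Rightarrow> (real \<times> 'a) set \<Rightarrow> bool" where
  "inner_regular_at T D \<longleftrightarrow> graph_event T D \<in> events \<and>
     (\<forall>e>0. \<exists>Y. cont_adapted Y \<and> zeros Y \<subseteq> D \<and>
        prob (graph_event T D - graph_event T (zeros Y)) < e)"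

lemma cont_adaptedI:
  assumes "\<And>t. 0 \<le> t \<Longrightarrow> Y t \<in> borel_measurable (F (ennreal t))"
    and "\<And>\<omega>. \<omega> \<in> space M \<Longrightarrow> continuous_on {0..} (\<lambda>t. Y t \<omega>)"
    and "\<And>\<omega> t. \<omega> \<in> space M \<Longrightarrow> 0 \<le> t \<Longrightarrow> 0 \<le> Y t \<omega>"
  shows "cont_adapted Y"
  using assms unfolding cont_adapted_def by blast

lemma cont_adaptedD:
  assumes "cont_adapted Y"
  shows "0 \<le> t \<Longrightarrow> Y t \<in> borel_measurable (F (ennreal t))"
    and "\<omega> \<in> space M \<Longrightarrow> continuous_on {0..} (\<lambda>t. Y t \<omega>)"
    and "\<omega> \<in> space M \<Longrightarrow> 0 \<le> t \<Longrightarrow> 0 \<le> Y t \<omega>"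
  using assms unfolding cont_adapted_def by blast+

section \<open>Stability of zero sets under finite unions and countable intersections\<close>

lemma cont_adapted_prod:
  fixes Y :: "nat \<Rightarrow> real \<Rightarrow> 'a \<Rightarrow> real"
  assumes "\<And>i. cont_adapted (Y i)"
  shows "cont_adapted (\<lambda>t \<omega>. \<Prod>i<n. Y i t \<omega>)"
    and "zeros (\<lambda>t \<omega>. \<Prod>i<n. Y i t \<omega>) = (\<Union>i<n. zeros (Y i))"
proof -
  note Y = cont_adaptedD[OF assms]
  show "cont_adapted (\<lambda>t \<omega>. \<Prod>i<n. Y i t \<omega>)"
  proof (rule cont_adaptedI)
    show "(\<lambda>\<omega>. \<Prod>i<n. Y i t \<omega>) \<in> borel_measurable (F (ennreal t))" if "0 \<le> t" for t
      by (rule borel_measurable_prod) (rule Y(1)[OF that])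
    show "continuous_on {0..} (\<lambda>t. \<Prod>i<n. Y i t \<omega>)" if "\<omega> \<in> space M" for \<omega>
      by (rule continuous_on_prod) (rule Y(2)[OF that])
    show "0 \<le> (\<Prod>i<n. Y i t \<omega>)" if "\<omega> \<in> space M" "0 \<le> t" for \<omega> t
      by (rule prod_nonneg) (simp add: Y(3)[OF that])
  qed
  show "zeros (\<lambda>t \<omega>. \<Prod>i<n. Y i t \<omega>) = (\<Union>i<n. zeros (Y i))"
    by (auto simp: zeros_def)
qed

text \<open>Truncation at 1 and geometric weights make the series uniformly convergent, so
  continuity survives. As all terms are nonnegative, the sum is zero only where each term
  is.\<close>

lemma cont_adapted_suminf:
  fixes Y :: "nat \<Rightarrow> real \<Rightarrow> 'a \<Rightarrow> real"
  assumes "\<And>i. cont_adapted (Y i)"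
  defines "S \<equiv> \<lambda>t \<omega>. \<Sum>i. min 1 (Y i t \<omega>) * (1/2)^i"
  shows "cont_adapted S" and "zeros S = (\<Inter>i. zeros (Y i))"
proof -
  note Y = cont_adaptedD[OF assms(1)]
  have sgeo: "summable (\<lambda>i. (1/2::real)^i)" by (rule summable_geometric) simp
  have bd: "norm (min 1 (Y i t \<omega>) * (1/2)^i) \<le> (1/2)^i" if "\<omega> \<in> space M" "0 \<le> t" for i t \<omega>
  proof -
    have "\<bar>min 1 (Y i t \<omega>)\<bar> \<le> 1" using Y(3)[OF that, of i] by simp
    then show ?thesis by (simp add: abs_mult mult_left_le_one_le)
  qed
  have sm: "summable (\<lambda>i. min 1 (Y i t \<omega>) * (1/2)^i)" if "\<omega> \<in> space M" "0 \<le> t" for t \<omega>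
    by (rule summable_comparison_test'[OF sgeo]) (rule bd[OF that])
  have nn: "0 \<le> min 1 (Y i t \<omega>) * (1/2)^i" if "\<omega> \<in> space M" "0 \<le> t" for i t \<omega>
    using Y(3)[OF that, of i] by simp
  show "cont_adapted S"
  proof (rule cont_adaptedI)
    show "S t \<in> borel_measurable (F (ennreal t))" if "0 \<le> t" for t
      unfolding S_def
      by (intro borel_measurable_suminf borel_measurable_times borel_measurable_min
          borel_measurable_const Y(1)[OF that])
    show "continuous_on {0..} (\<lambda>t. S t \<omega>)" if w: "\<omega> \<in> space M" for \<omega>
    proof -
      have u: "uniform_limit {0..} (\<lambda>n t. \<Sum>i<n. min 1 (Y i t \<omega>) * (1/2)^i) (\<lambda>t. S t \<omega>) sequentially"
        unfolding S_def by (rule Weierstrass_m_test[OF _ sgeo]) (rule bd[OF w], simp)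
      have "continuous_on {0..} (\<lambda>t. \<Sum>i<n. min 1 (Y i t \<omega>) * (1/2)^i)" for n
        by (intro continuous_on_sum continuous_on_mult continuous_on_min continuous_on_const Y(2)[OF w])
      then have "\<forall>\<^sub>F n in sequentially. continuous_on {0..} (\<lambda>t. \<Sum>i<n. min 1 (Y i t \<omega>) * (1/2)^i)"
        by simp
      then show ?thesis by (rule uniform_limit_theorem[OF _ u sequentially_bot])
    qed
    show "0 \<le> S t \<omega>" if "\<omega> \<in> space M" "0 \<le> t" for \<omega> t
      unfolding S_def by (rule suminf_nonneg[OF sm[OF that] nn[OF that]])
  qed
  have "S t \<omega> = 0 \<longleftrightarrow> (\<forall>i. Y i t \<omega> = 0)" if "\<omega> \<in> space M" "0 \<le> t" for t \<omega>
  proof -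
    have min0: "min 1 y * c = 0 \<longleftrightarrow> y = 0" if "c \<noteq> 0" for y c :: real
      using that by (simp add: min_def)
    have "S t \<omega> = 0 \<longleftrightarrow> (\<forall>i. min 1 (Y i t \<omega>) * (1/2)^i = 0)"
      unfolding S_def by (rule suminf_eq_zero_iff[OF sm[OF that] nn[OF that]])
    then show ?thesis by (subst (asm) min0) simp_all
  qed
  then show "zeros S = (\<Inter>i. zeros (Y i))"
    unfolding zeros_def by auto
qed

definition predictable_rects :: "(real \<times> 'a) set set" where
  "predictable_rects = {{0} \<times> B | B. B \<in> sets (F 0)} \<union>
     {{s<..t} \<times> B | s t B. 0 \<le> s \<and> s \<le> t \<and> B \<in> sets (F (ennreal s))}"

lemma predictable_rectsE:
  assumes "D \<in> predictable_rects"
  obtains B where "B \<in> sets (F 0)" "D = {0} \<times> B"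
  | s t B where "0 \<le> s" "s \<le> t" "B \<in> sets (F (ennreal s))" "D = {s<..t} \<times> B"
  using assms unfolding predictable_rects_def by blast

lemma F_sets_into_space: "B \<in> sets (F t) \<Longrightarrow> B \<subseteq> space M"
  using sets.sets_into_space[of B "F t"] by (simp add: space_F)

lemma F_sets_space: "space M \<in> sets (F t)"
  using sets.top[of "F t"] by (simp add: space_F)

lemma F_sets_compl: "B \<in> sets (F t) \<Longrightarrow> space M - B \<in> sets (F t)"
  using sets.compl_sets[of B "F t"] by (simp add: space_F)

lemma predictable_rects_Pow: "predictable_rects \<subseteq> Pow ({0..} \<times> space M)"
proof (rule subsetI, rule PowI)
  fix D assume "D \<in> predictable_rects"
  then show "D \<subseteq> {0..} \<times> space M"
  proof (cases rule: predictable_rectsE)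
    case (1 B)
    then show ?thesis using F_sets_into_space[of B 0] by (intro subsetI) auto
  next
    case (2 s t B)
    then show ?thesis using F_sets_into_space[of B "ennreal s"] by (intro subsetI) auto
  qed
qed

lemma sets_predictable_sigma:
  "sets (predictable_sigma (space M) F) = sigma_sets ({0..} \<times> space M) predictable_rects"
  using predictable_rects_Pow unfolding predictable_sigma_def predictable_rects_def
  by (rule sets_measure_of)

context
  fixes T :: "'a \<Rightarrow> real"
  assumes T[measurable]: "T \<in> borel_measurable M" and T0: "\<And>\<omega>. \<omega> \<in> space M \<Longrightarrow> 0 \<le> T \<omega>"
begin

lemma graph_event_zeros:
  assumes "cont_adapted Y" shows "graph_event T (zeros Y) \<in> events"
proof -
  note Y = cont_adaptedD[OF assms]
  have [measurable]: "(\<lambda>\<omega>. Y (T \<omega>) \<omega>) \<in> borel_measurable M"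
  proof (rule measurable_sample_right_continuous[OF _ _ T T0])
    show "Y t \<in> borel_measurable M" if "0 \<le> t" for t
      by (rule measurable_F_M[OF Y(1)[OF that]])
    show "continuous (at_right t) (\<lambda>t. Y t \<omega>)" if "\<omega> \<in> space M" "0 \<le> t" for \<omega> t
    proof -
      have "continuous (at t within {0..}) (\<lambda>t. Y t \<omega>)"
        using Y(2)[OF that(1)] that(2) by (simp add: continuous_on_eq_continuous_within)
      then show ?thesis by (rule continuous_within_subset) (use that(2) in auto)
    qed
  qed
  have "graph_event T (zeros Y) = {\<omega> \<in> space M. Y (T \<omega>) \<omega> = 0}"
    unfolding graph_event_def zeros_def using T0 by auto
  then show ?thesis by simp
qed

lemma inner_regular_at_zeros:
  assumes "cont_adapted Y" "zeros Y = D" shows "inner_regular_at T D"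
  unfolding inner_regular_at_def assms(2)[symmetric]
  using assms(1) graph_event_zeros[OF assms(1)] by auto

text \<open>Allowing the error \<open>(e/4) * (1/2)^i\<close> for the \<open>i\<close>-th set gives
  a total of \<open>e/2\<close>, which keeps the final bound strict.\<close>

lemma inner_regular_choose:
  fixes D :: "nat \<Rightarrow> (real \<times> 'a) set"
  assumes D: "\<And>i. inner_regular_at T (D i)" and e: "0 < e"
  obtains Y where "\<And>i. cont_adapted (Y i)" "\<And>i. zeros (Y i) \<subseteq> D i"
    "(\<Union>i. graph_event T (D i) - graph_event T (zeros (Y i))) \<in> events"
    "prob (\<Union>i. graph_event T (D i) - graph_event T (zeros (Y i))) < e"
proof -
  have "\<exists>Y. cont_adapted Y \<and> zeros Y \<subseteq> D i \<and>
      prob (graph_event T (D i) - graph_event T (zeros Y)) < (e/4) * (1/2)^i" for i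
  proof -
    have "0 < (e/4) * (1/2)^i" using e by simp
    then show ?thesis using D[of i] unfolding inner_regular_at_def by blast
  qed
  then obtain Y where Y: "\<And>i. cont_adapted (Y i)" "\<And>i. zeros (Y i) \<subseteq> D i"
    "\<And>i. prob (graph_event T (D i) - graph_event T (zeros (Y i))) < (e/4) * (1/2)^i"
    by metis
  let ?B = "\<lambda>i. graph_event T (D i) - graph_event T (zeros (Y i))"
  have B: "?B i \<in> events" for i
    using D[of i] graph_event_zeros[OF Y(1)] unfolding inner_regular_at_def by auto
  have "(\<lambda>i. (e/4) * (1/2::real)^i) sums ((e/4) * (1 / (1 - 1/2)))"
    by (intro sums_mult geometric_sums) simp
  then have geo: "summable (\<lambda>i. (e/4) * (1/2::real)^i)" "(\<Sum>i. (e/4) * (1/2::real)^i) = e/2"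
    by (auto simp: sums_iff)
  have sm: "summable (\<lambda>i. prob (?B i))"
  proof (rule summable_comparison_test'[OF geo(1), of 0])
    show "norm (prob (?B i)) \<le> (e/4) * (1/2)^i" for i
      using less_imp_le[OF Y(3)[of i]] by (simp only: real_norm_def abs_of_nonneg[OF measure_nonneg])
  qed
  have "prob (\<Union>i. ?B i) \<le> (\<Sum>i. prob (?B i))"
    by (rule finite_measure_subadditive_countably[OF _ sm]) (use B in auto)
  also have "\<dots> \<le> e / 2"
    unfolding geo(2)[symmetric] by (rule suminf_le[OF less_imp_le[OF Y(3)] sm geo(1)])
  also have "\<dots> < e" using e by simp
  finally have "prob (\<Union>i. ?B i) < e" .
  moreover have "(\<Union>i. ?B i) \<in> events" using B by blast
  ultimately show ?thesis by (intro that[of Y] Y(1,2))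
qed

text \<open>What the intersection loses is covered by what the single sets lose, and the
  intersection of the approximating zero sets is again a zero set.\<close>

lemma inner_regular_at_INT:
  fixes D :: "nat \<Rightarrow> (real \<times> 'a) set"
  assumes D: "\<And>i. inner_regular_at T (D i)"
  shows "inner_regular_at T (\<Inter>i. D i)"
proof -
  have G: "graph_event T (\<Inter>i. D i) = (\<Inter>i. graph_event T (D i))"
    by (auto simp: graph_event_def)
  have ev: "graph_event T (\<Inter>i. D i) \<in> events"
    unfolding G using D by (intro sets.countable_INT) (auto simp: inner_regular_at_def)
  have "\<exists>Z. cont_adapted Z \<and> zeros Z \<subseteq> (\<Inter>i. D i) \<and>
      prob (graph_event T (\<Inter>i. D i) - graph_event T (zeros Z)) < e" if e: "0 < e" for e
  proof -
    obtain Y where Y: "\<And>i. cont_adapted (Y i)" "\<And>i. zeros (Y i) \<subseteq> D i"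
      and B: "(\<Union>i. graph_event T (D i) - graph_event T (zeros (Y i))) \<in> events"
        "prob (\<Union>i. graph_event T (D i) - graph_event T (zeros (Y i))) < e"
      by (rule inner_regular_choose[of D, OF D e]) blast
    note Z = cont_adapted_suminf[of Y, OF Y(1)]
    let ?Z = "\<lambda>t \<omega>. \<Sum>i. min 1 (Y i t \<omega>) * (1/2)^i"
    have "graph_event T (\<Inter>i. D i) - graph_event T (zeros ?Z)
        \<subseteq> (\<Union>i. graph_event T (D i) - graph_event T (zeros (Y i)))"
      unfolding Z(2) by (auto simp: graph_event_def)
    then have "prob (graph_event T (\<Inter>i. D i) - graph_event T (zeros ?Z)) < e"
      by (rule le_less_trans[OF finite_measure_mono[OF _ B(1)] B(2)])
    moreover have "zeros ?Z \<subseteq> (\<Inter>i. D i)" unfolding Z(2) using Y(2) by blast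
    ultimately show ?thesis using Z(1) by blast
  qed
  with ev show ?thesis unfolding inner_regular_at_def by blast
qed

text \<open>A countable union of zero sets need not be a zero set, but a finite one is. The losses
  \<open>C n\<close> of the finite unions decrease to a set of probability below \<open>e\<close>,
  so by continuity from above some \<open>n\<close> suffices.\<close>

lemma inner_regular_at_UN:
  fixes D :: "nat \<Rightarrow> (real \<times> 'a) set"
  assumes D: "\<And>i. inner_regular_at T (D i)"
  shows "inner_regular_at T (\<Union>i. D i)"
proof -
  have G: "graph_event T (\<Union>i. D i) = (\<Union>i. graph_event T (D i))"
    by (auto simp: graph_event_def)
  have ev: "graph_event T (\<Union>i. D i) \<in> events"
    unfolding G using D by (intro sets.countable_UN) (auto simp: inner_regular_at_def)
  have "\<exists>Z. cont_adapted Z \<and> zeros Z \<subseteq> (\<Union>i. D i) \<and>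
      prob (graph_event T (\<Union>i. D i) - graph_event T (zeros Z)) < e" if e: "0 < e" for e
  proof -
    obtain Y where Y: "\<And>i. cont_adapted (Y i)" "\<And>i. zeros (Y i) \<subseteq> D i"
      and B: "(\<Union>i. graph_event T (D i) - graph_event T (zeros (Y i))) \<in> events"
        "prob (\<Union>i. graph_event T (D i) - graph_event T (zeros (Y i))) < e"
      by (rule inner_regular_choose[of D, OF D e]) blast
    define Z where "Z n = (\<lambda>t \<omega>. \<Prod>i<n. Y i t \<omega>)" for n :: nat
    have Z: "cont_adapted (Z n)" "zeros (Z n) = (\<Union>i<n. zeros (Y i))" for n
      unfolding Z_def by (rule cont_adapted_prod[OF Y(1)])+
    define C where "C n = graph_event T (\<Union>i. D i) - graph_event T (zeros (Z n))" for n
    have C: "C n \<in> events" for n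
      unfolding C_def using ev graph_event_zeros[OF Z(1)] by blast
    have "decseq C"
      by (rule decseq_SucI) (auto simp: C_def Z(2) graph_event_def)
    then have "(\<lambda>n. prob (C n)) \<longlonglongrightarrow> prob (\<Inter>n. C n)"
      by (intro finite_Lim_measure_decseq) (use C in auto)
    moreover have "(\<Inter>n. C n) \<subseteq> (\<Union>i. graph_event T (D i) - graph_event T (zeros (Y i)))"
      by (auto simp: C_def Z(2) graph_event_def)
    then have "prob (\<Inter>n. C n) < e"
      by (rule le_less_trans[OF finite_measure_mono[OF _ B(1)] B(2)])
    ultimately have "eventually (\<lambda>n. prob (C n) < e) sequentially"
      by (rule order_tendstoD(2))
    then obtain n where "prob (C n) < e"
      using eventually_sequentially by auto
    moreover have "zeros (Z n) \<subseteq> (\<Union>i. D i)" unfolding Z(2) using Y(2) by blast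
    ultimately show ?thesis using Z(1) unfolding C_def by blast
  qed
  with ev show ?thesis unfolding inner_regular_at_def by blast
qed

lemma inner_regular_at_Un:
  assumes "inner_regular_at T D" "inner_regular_at T E"
  shows "inner_regular_at T (D \<union> E)"
proof -
  have "inner_regular_at T (\<Union>i::nat. if i = 0 then D else E)"
    by (rule inner_regular_at_UN) (simp add: assms)
  also have "(\<Union>i::nat. if i = 0 then D else E) = D \<union> E"
    by (auto split: if_splits)
  finally show ?thesis .
qed

section \<open>From rectangles to all predictable sets\<close>

lemma cont_adapted_rectangle:
  fixes s t d :: real
  assumes B: "B \<in> sets (F (ennreal s))" and s: "0 \<le> s" and d: "0 < d"
  defines "Y \<equiv> \<lambda>u \<omega>. if \<omega> \<in> B then min 1 (max 0 (max (s + d - u) (u - t)) / d) else 1"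
  shows "cont_adapted Y" "zeros Y = {s + d..t} \<times> B"
proof -
  have BM: "B \<subseteq> space M" using sets.sets_into_space[OF B] by (simp add: space_F)
  show "cont_adapted Y"
  proof (rule cont_adaptedI)
    show "Y u \<in> borel_measurable (F (ennreal u))" if "0 \<le> u" for u
    proof (cases "s \<le> u")
      case True
      have [measurable]: "B \<in> sets (F (ennreal u))"
        using B sets_F_mono[OF ennreal_leI[OF True]] by blast
      show ?thesis unfolding Y_def by measurable
    next
      case False
      \<comment> \<open>For \<open>s + d \<le> t\<close> the process is, on \<open>B\<close>, the
        distance to the interval from \<open>s + d\<close> to \<open>t\<close> in units of
        \<open>d\<close>, capped at 1. Before time \<open>s\<close> the cap is active, so the
        process is constant as long as \<open>B\<close> may be unobserved.\<close>
      then have "1 \<le> max 0 (max (s + d - u) (u - t)) / d" using d by (simp add: le_divide_eq)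
      then have "Y u = (\<lambda>_. 1)" unfolding Y_def by (auto simp: fun_eq_iff)
      then show ?thesis by simp
    qed
    show "continuous_on {0..} (\<lambda>u. Y u \<omega>)" for \<omega>
      unfolding Y_def by (cases "\<omega> \<in> B") (auto intro!: continuous_intros simp: d[THEN less_imp_neq, symmetric])
    show "0 \<le> Y u \<omega>" for u \<omega> unfolding Y_def using d by auto
  qed
  show "zeros Y = {s + d..t} \<times> B"
    unfolding zeros_def Y_def using BM d s
    by (auto simp: min_def max_def divide_le_eq split: if_splits)
qed

lemma cont_adapted_rectangle0:
  fixes t :: real
  assumes B: "B \<in> sets (F 0)"
  defines "Y \<equiv> \<lambda>u \<omega>. if \<omega> \<in> B then max 0 (u - t) else 1"
  shows "cont_adapted Y" "zeros Y = {0..t} \<times> B"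
proof -
  have BM: "B \<subseteq> space M" using sets.sets_into_space[OF B] by (simp add: space_F)
  show "cont_adapted Y"
  proof (rule cont_adaptedI)
    show "Y u \<in> borel_measurable (F (ennreal u))" if "0 \<le> u" for u
    proof -
      have [measurable]: "B \<in> sets (F (ennreal u))"
        using B sets_F_mono[of 0 "ennreal u"] by auto
      show ?thesis unfolding Y_def by measurable
    qed
    show "continuous_on {0..} (\<lambda>u. Y u \<omega>)" for \<omega>
      unfolding Y_def by (cases "\<omega> \<in> B") (auto intro!: continuous_intros)
    show "0 \<le> Y u \<omega>" for u \<omega> unfolding Y_def by auto
  qed
  show "zeros Y = {0..t} \<times> B"
    unfolding zeros_def Y_def using BM by (auto simp: max_def split: if_splits)
qed

lemma inner_regular_at_rectangle:
  assumes B: "B \<in> sets (F (ennreal s))" and s: "0 \<le> s"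
  shows "inner_regular_at T ({s<..t} \<times> B)"
proof -
  have "inner_regular_at T (\<Union>n. {s + 1 / real (Suc n)..t} \<times> B)"
  proof (rule inner_regular_at_UN)
    fix n
    have "0 < 1 / real (Suc n)" by simp
    from inner_regular_at_zeros[OF cont_adapted_rectangle[OF B s this]]
    show "inner_regular_at T ({s + 1 / real (Suc n)..t} \<times> B)" .
  qed
  also have "(\<Union>n. {s + 1 / real (Suc n)..t} \<times> B) = {s<..t} \<times> B"
  proof (rule set_eqI, rule iffI)
    fix p assume "p \<in> {s<..t} \<times> B"
    then obtain u w where p: "p = (u, w)" "s < u" "u \<le> t" "w \<in> B" by auto
    then obtain n where "1 / real (Suc n) < u - s"
      using reals_Archimedean[of "u - s"] by (auto simp: inverse_eq_divide)
    then show "p \<in> (\<Union>n. {s + 1 / real (Suc n)..t} \<times> B)" using p by (auto intro!: exI[of _ n])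
  next
    fix p assume "p \<in> (\<Union>n. {s + 1 / real (Suc n)..t} \<times> B)"
    then obtain n where p: "p \<in> {s + 1 / real (Suc n)..t} \<times> B" by blast
    define c where "c = 1 / real (Suc n)"
    have "0 < c" unfolding c_def by simp
    then have "{s + c..t} \<subseteq> {s<..t}" by auto
    then have "{s + 1 / real (Suc n)..t} \<subseteq> {s<..t}" unfolding c_def .
    then show "p \<in> {s<..t} \<times> B" using p by blast
  qed
  finally show ?thesis .
qed

lemma inner_regular_at_tail:
  assumes B: "B \<in> sets (F (ennreal s))" and s: "0 \<le> s"
  shows "inner_regular_at T ({s<..} \<times> B)"
proof -
  have "inner_regular_at T (\<Union>n. {s<..real n} \<times> B)"
    by (intro inner_regular_at_UN inner_regular_at_rectangle B s)
  also have "(\<Union>n. {s<..real n} \<times> B) = {s<..} \<times> B"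
  proof (rule set_eqI, rule iffI)
    fix p assume "p \<in> {s<..} \<times> B"
    moreover obtain n where "fst p \<le> real n" using real_arch_simple by blast
    ultimately show "p \<in> (\<Union>n. {s<..real n} \<times> B)" by (auto intro!: exI[of _ n])
  qed auto
  finally show ?thesis .
qed

text \<open>Inner regularity does not pass to complements by itself, so the induction carries the
  claim for a set together with its complement. Complementation then only swaps the two halves, and
  a countable union uses the lemmas on unions and on intersections.\<close>

theorem inner_regular_at_predictable:
  assumes "D \<in> sets (predictable_sigma (space M) F)"
  shows "inner_regular_at T D"
proof -
  let ?U = "{0::real..} \<times> space M"
  note top = F_sets_space
  have "D \<in> sigma_sets ?U predictable_rects"
    using assms by (simp add: sets_predictable_sigma)
  then have "inner_regular_at T D \<and> inner_regular_at T (?U - D)"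
  proof (induction rule: sigma_sets.induct)
    case (Basic D)
    then show ?case
    proof (cases rule: predictable_rectsE)
      case (1 B)
      have 2: "inner_regular_at T ({0..0} \<times> B)" if "B \<in> sets (F 0)" for B
        by (rule inner_regular_at_zeros[OF cont_adapted_rectangle0[OF that]])
      have eq: "?U - D = {0<..} \<times> space M \<union> {0..0} \<times> (space M - B)"
        unfolding 1(2) by auto
      have "inner_regular_at T (?U - D)"
        unfolding eq by (intro inner_regular_at_Un inner_regular_at_tail 2 F_sets_compl 1(1) top order_refl)
      then show ?thesis using 2[OF 1(1)] 1(2) by simp
    next
      case (2 s t B)
      have 3: "inner_regular_at T ({0..s} \<times> space M)"
        by (rule inner_regular_at_zeros[OF cont_adapted_rectangle0[OF top]])
      have eq: "?U - D = {0..s} \<times> space M \<union> ({t<..} \<times> space M \<union> {s<..} \<times> (space M - B))"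
        unfolding 2(4) using 2(1,2) F_sets_into_space[OF 2(3)] by auto
      have "inner_regular_at T (?U - D)"
        unfolding eq
        by (intro inner_regular_at_Un 3 inner_regular_at_tail[OF top order_trans[OF 2(1,2)]]
            inner_regular_at_tail[OF F_sets_compl[OF 2(3)] 2(1)])
      then show ?thesis using inner_regular_at_rectangle[OF 2(3,1)] 2(4) by simp
    qed
  next
    case Empty
    \<comment> \<open>The interval \<open>{0 + 1..0}\<close> is empty, so the rectangle lemma
      exhibits the empty set as a zero set.\<close>
    have "inner_regular_at T ({0 + 1..0} \<times> space M)"
      by (rule inner_regular_at_zeros[OF cont_adapted_rectangle[OF top order_refl zero_less_one]])
    moreover have "inner_regular_at T ({0..0} \<times> space M)"
      by (rule inner_regular_at_zeros[OF cont_adapted_rectangle0[OF top]])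
    then have "inner_regular_at T ({0<..} \<times> space M \<union> {0..0} \<times> space M)"
      by (intro inner_regular_at_Un inner_regular_at_tail top order_refl)
    moreover have "{0<..} \<times> space M \<union> {0..0} \<times> space M = ?U" by auto
    ultimately show ?case by simp
  next
    case (Compl D)
    have "?U - (?U - D) = D"
      using sigma_sets_into_sp[OF predictable_rects_Pow Compl.hyps] by blast
    then show ?case using Compl.IH by simp
  next
    case (Union D)
    have "?U - (\<Union>i. D i) = (\<Inter>i. ?U - D i)" by blast
    then show ?case
      using inner_regular_at_UN[of D] inner_regular_at_INT[of "\<lambda>i. ?U - D i"] Union.IH by simp
  qed
  then show ?thesis ..
qed

end

end

section \<open>Quasi-left-continuity\<close>

lemma (in prob_space) bounded_convergence:
  fixes u :: "nat \<Rightarrow> 'a \<Rightarrow> real"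
  assumes u: "\<And>n. u n \<in> borel_measurable M"
    and bd: "\<And>n \<omega>. \<omega> \<in> space M \<Longrightarrow> \<bar>u n \<omega>\<bar> \<le> B"
    and lim: "\<And>\<omega>. \<omega> \<in> space M \<Longrightarrow> (\<lambda>n. u n \<omega>) \<longlonglongrightarrow> v \<omega>"
  shows "(\<lambda>n. expectation (u n)) \<longlonglongrightarrow> expectation v"
proof (rule integral_dominated_convergence)
  show "v \<in> borel_measurable M" by (rule borel_measurable_LIMSEQ_real[OF lim u])
  show "u n \<in> borel_measurable M" for n by (rule u)
  show "integrable M (\<lambda>_. B)" by simp
  show "AE \<omega> in M. (\<lambda>n. u n \<omega>) \<longlonglongrightarrow> v \<omega>" by (rule AE_I2[OF lim])
  show "AE \<omega> in M. norm (u n \<omega>) \<le> B" for n by (rule AE_I2) (simp add: bd)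
qed

lemma (in prob_space) abs_expectation_le:
  fixes u :: "'a \<Rightarrow> real"
  assumes u: "u \<in> borel_measurable M" and bd: "\<And>\<omega>. \<omega> \<in> space M \<Longrightarrow> \<bar>u \<omega>\<bar> \<le> B"
  shows "\<bar>expectation u\<bar> \<le> B"
proof -
  have i: "integrable M u" by (rule integrable_const_bound[of _ B]) (auto intro: AE_I2 simp: bd u)
  have "- B \<le> u \<omega>" "u \<omega> \<le> B" if "\<omega> \<in> space M" for \<omega> using bd[OF that] by auto
  then have "expectation u \<le> B" "- B \<le> expectation u"
    by (auto intro!: integral_le_const[OF i] integral_ge_const[OF i] AE_I2)
  then show ?thesis by simp
qed

section \<open>Functions vanishing at infinity\<close>

lemma C0_continuous: "f \<in> C0 \<Longrightarrow> continuous_on UNIV f"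
  by (simp add: C0_def)

lemma C0_measurable: "f \<in> C0 \<Longrightarrow> f \<in> borel_measurable borel"
  by (simp add: C0_def borel_measurable_continuous_onI)

lemma C0_bounded:
  assumes "f \<in> C0" obtains B where "\<And>y. \<bar>f y\<bar> \<le> B"
proof -
  have f0: "(f \<longlongrightarrow> 0) at_infinity" and c: "continuous_on UNIV f" using assms by (auto simp: C0_def)
  from f0 have "eventually (\<lambda>x. dist (f x) 0 < 1) at_infinity" by (rule tendstoD) simp
  then obtain b where b: "\<And>x. b \<le> norm x \<Longrightarrow> \<bar>f x\<bar> < 1"
    by (auto simp: eventually_at_infinity)
  have "compact (f ` cball 0 b)"
    by (intro compact_continuous_image continuous_on_subset[OF c]) auto
  from compact_imp_bounded[OF this] obtain B where B: "\<forall>x\<in>cball 0 b. \<bar>f x\<bar> \<le> B"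
    unfolding bounded_iff by auto
  have "\<bar>f y\<bar> \<le> max B 1" for y
  proof (cases "b \<le> norm y")
    case True
    then show ?thesis using b[of y] by simp
  next
    case False
    then show ?thesis using B[rule_format, of y] by simp
  qed
  then show ?thesis by (rule that)
qed

lemma C0_power2:
  assumes "f \<in> C0" shows "(\<lambda>y. (f y)\<^sup>2) \<in> C0"
proof -
  have "((\<lambda>y. (f y)\<^sup>2) \<longlongrightarrow> 0\<^sup>2) at_infinity"
    using assms by (intro tendsto_power) (simp add: C0_def)
  moreover have "continuous_on UNIV (\<lambda>y. (f y)\<^sup>2)"
    using assms by (intro continuous_on_power) (simp add: C0_def)
  ultimately show ?thesis by (simp add: C0_def)
qed

lemma C0_bounded_range: "f \<in> C0 \<Longrightarrow> bounded (range f)"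
  by (erule C0_bounded) (auto simp: bounded_iff)

lemma tendsto_C0: "f \<in> C0 \<Longrightarrow> (s \<longlongrightarrow> l) G \<Longrightarrow> ((\<lambda>n. f (s n)) \<longlongrightarrow> f l) G"
  using C0_continuous[of f] continuous_on_tendsto_compose[of UNIV f s l G] by simp

text \<open>No single function in \<^const>\<open>C0\<close> is injective on the line, but these two together separate
  points.\<close>

lemma separating_C0:
  "(\<lambda>y::real. 1 / (1 + y\<^sup>2)) \<in> C0" "(\<lambda>y::real. y / (1 + y\<^sup>2)) \<in> C0"
  and separating_C0_inj: "\<And>y z::real. 1 / (1 + y\<^sup>2) = 1 / (1 + z\<^sup>2) \<Longrightarrow>
    y / (1 + y\<^sup>2) = z / (1 + z\<^sup>2) \<Longrightarrow> y = z"
proof -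
  have pos: "1 + y\<^sup>2 \<noteq> 0" for y :: real using zero_le_power2[of y] by linarith
  have "((\<lambda>y::real. 1 / (1 + y\<^sup>2)) \<longlongrightarrow> 0) at_top" "((\<lambda>y::real. 1 / (1 + y\<^sup>2)) \<longlongrightarrow> 0) at_bot"
    "((\<lambda>y::real. y / (1 + y\<^sup>2)) \<longlongrightarrow> 0) at_top" "((\<lambda>y::real. y / (1 + y\<^sup>2)) \<longlongrightarrow> 0) at_bot"
    by real_asymp+
  moreover have "continuous_on UNIV (\<lambda>y::real. 1 / (1 + y\<^sup>2))" "continuous_on UNIV (\<lambda>y::real. y / (1 + y\<^sup>2))"
    by (intro continuous_intros ballI pos)+
  ultimately show "(\<lambda>y::real. 1 / (1 + y\<^sup>2)) \<in> C0" "(\<lambda>y::real. y / (1 + y\<^sup>2)) \<in> C0"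
    by (auto simp: C0_def at_infinity_eq_at_top_bot intro: filterlim_sup)
  fix y z :: real
  assume a: "1 / (1 + y\<^sup>2) = 1 / (1 + z\<^sup>2)" "y / (1 + y\<^sup>2) = z / (1 + z\<^sup>2)"
  have "1 + y\<^sup>2 = 1 + z\<^sup>2" using a(1) by (metis div_by_1 divide_divide_eq_right mult_1)
  then show "y = z" using a(2) pos[of z] by simp
qed

text \<open>The name joins the strong Markov property and the Feller property; the strong Feller
  property of semigroups is not meant.\<close>

locale strong_feller_process = strong_markov_process P X + feller_process P X
  for P :: "real \<Rightarrow> 'a measure" and X :: "real \<Rightarrow> 'a \<Rightarrow> real" +
  fixes x :: real
  assumes cadlag: "\<And>\<omega>. \<omega> \<in> space (P x) \<Longrightarrow> cadlag (\<lambda>t. X t \<omega>)"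
begin

abbreviation "Px \<equiv> completion (P x)"
abbreviation "Fx \<equiv> completed_filtration (P x) X"

sublocale filtered_prob_space Px Fx
proof -
  interpret P: prob_space "P x" by (rule prob_space_P)
  interpret prob_space Px by (rule P.prob_space_completion)
  interpret filtration "space Px" Fx using filtration_completed_filtration[of "P x" X] by simp
  show "filtered_prob_space Px Fx"
  proof
    show "sets (Fx t) \<subseteq> sets Px" for t
      using subalgebra_completed_filtration[OF measurable_X] by (simp add: subalgebra_def)
  qed
qed

lemma X_measurable: "0 \<le> t \<Longrightarrow> X t \<in> borel_measurable Px"
  by (rule measurable_completion[OF measurable_X])

lemma X_right_continuous:
  "\<omega> \<in> space Px \<Longrightarrow> 0 \<le> t \<Longrightarrow> continuous (at_right t) (\<lambda>t. X t \<omega>)"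
  using cadlag[of \<omega>] by (simp add: cadlag_def)

lemma X_left_limit:
  assumes "\<omega> \<in> space Px" "0 < t"
  shows "((\<lambda>t. X t \<omega>) \<longlongrightarrow> Lim (at_left t) (\<lambda>t. X t \<omega>)) (at_left t)"
proof -
  obtain l where l: "((\<lambda>t. X t \<omega>) \<longlongrightarrow> l) (at_left t)"
    using cadlag[of \<omega>] assms by (auto simp: cadlag_def)
  then show ?thesis unfolding tendsto_Lim[OF trivial_limit_at_left_real l] .
qed

lemma X_sample_measurable:
  assumes "T \<in> borel_measurable Px" "\<And>\<omega>. 0 \<le> T \<omega>" "0 \<le> t"
  shows "(\<lambda>\<omega>. X (T \<omega> + t) \<omega>) \<in> borel_measurable Px"
  by (rule measurable_sample_right_continuous[OF X_measurable X_right_continuous])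
    (use assms in auto)

section \<open>Strong Markov property at a finite stopping time\<close>

context
  fixes T :: "'a \<Rightarrow> real"
  assumes T: "stopping_time Fx (\<lambda>\<omega>. ennreal (T \<omega>))" and T0: "\<And>\<omega>. 0 \<le> T \<omega>"
begin

lemma real_stopping_time_measurable: "T \<in> borel_measurable Px"
proof -
  have "(\<lambda>\<omega>. ennreal (T \<omega>)) \<in> borel_measurable Px"
    by (rule measurable_stopping_time[OF T F_le]) (rule space_F)
  then have "(\<lambda>\<omega>. enn2real (ennreal (T \<omega>))) \<in> borel_measurable Px" by measurable
  then show ?thesis using T0 by simp
qed

lemma X_sample_measurable': "0 \<le> t \<Longrightarrow> (\<lambda>\<omega>. X (T \<omega> + t) \<omega>) \<in> borel_measurable Px"
  by (rule X_sample_measurable[OF real_stopping_time_measurable T0])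

lemma C0_sample:
  assumes "f \<in> C0" "0 \<le> t"
  shows "(\<lambda>\<omega>. f (X (T \<omega> + t) \<omega>)) \<in> borel_measurable Px" "integrable Px (\<lambda>\<omega>. f (X (T \<omega> + t) \<omega>))"
proof -
  show m: "(\<lambda>\<omega>. f (X (T \<omega> + t) \<omega>)) \<in> borel_measurable Px"
    by (rule measurable_compose[OF X_sample_measurable'[OF assms(2)] C0_measurable[OF assms(1)]])
  obtain B where "\<And>y. \<bar>f y\<bar> \<le> B" by (rule C0_bounded[OF assms(1)]) blast
  then show "integrable Px (\<lambda>\<omega>. f (X (T \<omega> + t) \<omega>))"
    by (intro integrable_const_bound[of _ B] AE_I2 m) simp
qed

lemma strong_markov_cond_exp:
  assumes f: "f \<in> C0" and t: "0 \<le> t"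
  shows "AE \<omega> in Px. real_cond_exp Px (pre_sigma (\<lambda>\<omega>. ennreal (T \<omega>))) (\<lambda>\<omega>. f (X (T \<omega> + t) \<omega>)) \<omega>
    = transition_op P X t f (X (T \<omega>) \<omega>)"
  using strong_markov[OF T t C0_measurable[OF f] C0_bounded_range[OF f]] T0 by simp

lemma sigma_finite_subalgebra_pre_sigma:
  "sigma_finite_subalgebra Px (pre_sigma (\<lambda>\<omega>. ennreal (T \<omega>)))"
proof (rule finite_measure_subalgebra_is_sigma_finite, unfold_locales)
  show "subalgebra Px (pre_sigma (\<lambda>\<omega>. ennreal (T \<omega>)))"
    unfolding subalgebra_def
  proof
    show "space (pre_sigma (\<lambda>\<omega>. ennreal (T \<omega>))) = space Px" by (rule space_pre_sigma)
    show "sets (pre_sigma (\<lambda>\<omega>. ennreal (T \<omega>))) \<subseteq> sets Px"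
    proof
      fix A assume "A \<in> sets (pre_sigma (\<lambda>\<omega>. ennreal (T \<omega>)))"
      from sets_pre_sigmaD[OF T this, of \<top>] show "A \<in> sets Px" using F_le[of \<top>] by auto
    qed
  qed
qed

text \<open>This serves the constant factor 1, which is not in \<open>C0\<close> and hence outside
  the scope of \<open>strong_markov_expectation_mult\<close>.\<close>

lemma strong_markov_expectation:
  assumes f: "f \<in> C0" and t: "0 \<le> t"
  shows "expectation (\<lambda>\<omega>. f (X (T \<omega> + t) \<omega>)) =
    expectation (\<lambda>\<omega>. transition_op P X t f (X (T \<omega>) \<omega>))"
proof -
  interpret S: sigma_finite_subalgebra Px "pre_sigma (\<lambda>\<omega>. ennreal (T \<omega>))"
    by (rule sigma_finite_subalgebra_pre_sigma)
  have m: "(\<lambda>\<omega>. transition_op P X t f (X (T \<omega>) \<omega>)) \<in> borel_measurable Px"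
    using C0_sample(1)[OF feller_C0[OF f t] order_refl] by simp
  have "expectation (\<lambda>\<omega>. f (X (T \<omega> + t) \<omega>)) =
     expectation (real_cond_exp Px (pre_sigma (\<lambda>\<omega>. ennreal (T \<omega>))) (\<lambda>\<omega>. f (X (T \<omega> + t) \<omega>)))"
    by (rule S.real_cond_exp_int(2)[symmetric, OF C0_sample(2)[OF f t]])
  also have "\<dots> = expectation (\<lambda>\<omega>. transition_op P X t f (X (T \<omega>) \<omega>))"
    by (rule integral_cong_AE[OF borel_measurable_cond_exp2 m strong_markov_cond_exp[OF f t]])
  finally show ?thesis .
qed

text \<open>The strong Markov property at time \<open>0\<close> shows that \<open>h(X\<^sub>T)\<close> agrees almost surely with a
  \<open>F\<^sub>T\<close>-measurable variable, so that no progressive measurability is needed.\<close>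

lemma strong_markov_expectation_mult:
  assumes h: "h \<in> C0" and f: "f \<in> C0" and t: "0 \<le> t"
  shows "expectation (\<lambda>\<omega>. h (X (T \<omega>) \<omega>) * f (X (T \<omega> + t) \<omega>)) =
    expectation (\<lambda>\<omega>. h (X (T \<omega>) \<omega>) * transition_op P X t f (X (T \<omega>) \<omega>))"
proof -
  let ?G = "pre_sigma (\<lambda>\<omega>. ennreal (T \<omega>))"
  interpret S: sigma_finite_subalgebra Px ?G
    by (rule sigma_finite_subalgebra_pre_sigma)
  define Z where "Z = real_cond_exp Px ?G (\<lambda>\<omega>. h (X (T \<omega>) \<omega>))"
  have Zh: "AE \<omega> in Px. Z \<omega> = h (X (T \<omega>) \<omega>)"
    using strong_markov_cond_exp[OF h order_refl] unfolding Z_def by (simp add: feller_id[OF h])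
  have ZG: "Z \<in> borel_measurable ?G" unfolding Z_def by (rule borel_measurable_cond_exp)
  have ZM: "Z \<in> borel_measurable Px" unfolding Z_def by (rule borel_measurable_cond_exp2)
  have mh: "(\<lambda>\<omega>. h (X (T \<omega>) \<omega>)) \<in> borel_measurable Px"
    using C0_sample(1)[OF h order_refl] by simp
  have mQ: "(\<lambda>\<omega>. transition_op P X t f (X (T \<omega>) \<omega>)) \<in> borel_measurable Px"
    using C0_sample(1)[OF feller_C0[OF f t] order_refl] by simp
  note mf = C0_sample(1)[OF f t]
  obtain B where B: "\<And>y. \<bar>h y\<bar> \<le> B" by (rule C0_bounded[OF h]) blast
  obtain C where C: "\<And>y. \<bar>f y\<bar> \<le> C" by (rule C0_bounded[OF f]) blast
  have bd: "\<bar>h y * f z\<bar> \<le> B * C" for y z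
    using mult_mono'[OF B[of y] C[of z]] by (simp add: abs_mult)
  have "integrable Px (\<lambda>\<omega>. h (X (T \<omega>) \<omega>) * f (X (T \<omega> + t) \<omega>))"
    by (intro integrable_const_bound[of _ "B * C"] AE_I2 borel_measurable_times mh mf) (simp add: bd)
  then have i: "integrable Px (\<lambda>\<omega>. Z \<omega> * f (X (T \<omega> + t) \<omega>))"
    by (rule integrable_cong_AE_imp) (use Zh in \<open>auto intro!: borel_measurable_times ZM mf\<close>)
  have "expectation (\<lambda>\<omega>. h (X (T \<omega>) \<omega>) * f (X (T \<omega> + t) \<omega>)) =
      expectation (\<lambda>\<omega>. Z \<omega> * f (X (T \<omega> + t) \<omega>))"
    by (rule integral_cong_AE) (use Zh in \<open>auto intro!: borel_measurable_times ZM mh mf\<close>)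
  also have "\<dots> = expectation (\<lambda>\<omega>. Z \<omega> * real_cond_exp Px ?G (\<lambda>\<omega>. f (X (T \<omega> + t) \<omega>)) \<omega>)"
    by (rule S.real_cond_exp_intg(2)[OF i ZG mf, symmetric])
  also have "\<dots> = expectation (\<lambda>\<omega>. h (X (T \<omega>) \<omega>) * transition_op P X t f (X (T \<omega>) \<omega>))"
  proof (rule integral_cong_AE)
    show "AE \<omega> in Px. Z \<omega> * real_cond_exp Px ?G (\<lambda>\<omega>. f (X (T \<omega> + t) \<omega>)) \<omega> =
        h (X (T \<omega>) \<omega>) * transition_op P X t f (X (T \<omega>) \<omega>)"
      using Zh strong_markov_cond_exp[OF f t] by eventually_elim simp
  qed (intro borel_measurable_times ZM mh mQ borel_measurable_cond_exp2)+
  finally show ?thesis .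
qed

end


lemma transition_op_abs_le:
  assumes f: "f \<in> borel_measurable borel" and B: "\<And>z. \<bar>f z\<bar> \<le> B" and t: "0 \<le> t"
  shows "\<bar>transition_op P X t f y\<bar> \<le> B"
  unfolding transition_op_def
  by (rule prob_space.abs_expectation_le[OF prob_space_P])
    (rule measurable_compose[OF measurable_X[OF t] f], rule B)

section \<open>No jump at an announced time\<close>

context
  fixes Y :: "real \<Rightarrow> 'a \<Rightarrow> real" and b :: real
  assumes Y: "cont_adapted Y" and b: "0 \<le> b" and Yb: "\<And>\<omega>. \<omega> \<in> space Px \<Longrightarrow> Y b \<omega> = 0"
begin

text \<open>Let \<open>T n\<close> announce the first zero \<open>S\<close> and let \<open>L\<close>
  be the limit of the values of \<open>X\<close> at \<open>T n\<close>. The strong Markov property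
  at \<open>T n\<close>, first with \<open>n\<close> to infinity and then with the lag to 0, gives
  \<open>E (h L * g (X S)) = E (h L * g L)\<close>. The choices of \<open>h\<close> and
  \<open>g\<close> below make the mean square of \<open>h L - h (X S)\<close> vanish.\<close>

lemma quasi_left_continuous:
  "AE \<omega> in Px. 0 < hit Y 0 \<omega> \<longrightarrow>
     X (hit Y 0 \<omega>) \<omega> = Lim (at_left (hit Y 0 \<omega>)) (\<lambda>t. X t \<omega>)"
proof -
  \<comment> \<open>The maximum with 0 makes \<open>S\<close> and \<open>T n\<close> nonnegative
    also outside the sample space, as the strong Markov lemmas ask; it does not affect the stopping
    times after the cast to \<open>ennreal\<close>.\<close>
  define S where "S \<omega> = max 0 (hit Y 0 \<omega>)" for \<omega>
  define T where "T n \<omega> = max 0 (hit Y (1 / real (Suc n)) \<omega>)" for n \<omega>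
  have S_hit: "S \<omega> = hit Y 0 \<omega>" if "\<omega> \<in> space Px" for \<omega>
    using hit_attained(1)[OF Y b Yb that order_refl] by (simp add: S_def)
  have T_hit: "T n \<omega> = hit Y (1 / real (Suc n)) \<omega>" if "\<omega> \<in> space Px" for n \<omega>
    using hit_attained(1)[OF Y b Yb that, of "1 / real (Suc n)"] by (simp add: T_def)
  have S0: "0 \<le> S \<omega>" and T0: "0 \<le> T n \<omega>" for n \<omega> by (simp_all add: S_def T_def)
  have stS: "stopping_time Fx (\<lambda>\<omega>. ennreal (S \<omega>))"
    using stopping_time_hit[OF Y b Yb order_refl] by (simp add: S_def ennreal_max_0)
  have stT: "stopping_time Fx (\<lambda>\<omega>. ennreal (T n \<omega>))" for n
    using stopping_time_hit[OF Y b Yb, of "1 / real (Suc n)"] by (simp add: T_def ennreal_max_0)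
  have T_lim: "(\<lambda>n. T n \<omega>) \<longlonglongrightarrow> S \<omega>" if "\<omega> \<in> space Px" for \<omega>
    unfolding S_hit[OF that] T_hit[OF that] by (rule hit_tendsto[OF Y b Yb that])
  have T_less: "T n \<omega> < S \<omega>" if "\<omega> \<in> space Px" "S \<omega> \<noteq> 0" for n \<omega>
    using hit_less[OF Y b Yb that(1), of "1 / real (Suc n)"] that(2) S0[of \<omega>]
    unfolding S_hit[OF that(1)] T_hit[OF that(1)] by simp
  have T_zero: "T n \<omega> = 0" if "\<omega> \<in> space Px" "S \<omega> = 0" for n \<omega>
    using hit_antimono[OF Y b Yb that(1) order_refl, of "1 / real (Suc n)"] that(2) T0[of n \<omega>]
    unfolding S_hit[OF that(1)] T_hit[OF that(1)] by simp
  \<comment> \<open>\<open>V t\<close> is the limit of \<open>X\<close> at \<open>T n + t\<close>.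
    For \<open>S > 0\<close> these times approach \<open>S + t\<close> strictly from the left,
    whereas for \<open>S = 0\<close> all \<open>T n\<close> are 0 and nothing moves.\<close>
  define V where "V t \<omega> = (if S \<omega> = 0 then X t \<omega> else Lim (at_left (S \<omega> + t)) (\<lambda>t. X t \<omega>))" for t \<omega>
  have V_lim: "(\<lambda>n. X (T n \<omega> + t) \<omega>) \<longlonglongrightarrow> V t \<omega>" if w: "\<omega> \<in> space Px" and t: "0 \<le> t" for t \<omega>
  proof (cases "S \<omega> = 0")
    case True
    then show ?thesis by (simp add: V_def T_zero[OF w])
  next
    case False
    then have pos: "0 < S \<omega> + t" using S0[of \<omega>] t by linarith
    have "(\<lambda>n. T n \<omega> + t) \<longlonglongrightarrow> S \<omega> + t" by (intro tendsto_add T_lim[OF w] tendsto_const)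
    moreover have "T n \<omega> + t < S \<omega> + t" for n using T_less[OF w False] by simp
    ultimately have "filterlim (\<lambda>n. T n \<omega> + t) (at_left (S \<omega> + t)) sequentially"
      unfolding filterlim_at by (simp add: less_imp_neq)
    from filterlim_compose[OF X_left_limit[OF w pos] this] show ?thesis
      using False by (simp add: V_def)
  qed
  have mV: "V t \<in> borel_measurable Px" if "0 \<le> t" for t
    by (rule borel_measurable_LIMSEQ_real[OF V_lim[OF _ that] X_sample_measurable'[OF stT T0 that]])
  define d where "d k = 1 / real (Suc k)" for k
  have d_pos: "0 < d k" for k by (simp add: d_def)
  have d_lim: "d \<longlonglongrightarrow> 0" unfolding d_def by (intro LIMSEQ_Suc lim_1_over_n)
  \<comment> \<open>Although \<open>V (d k)\<close> is a left limit for \<open>S > 0\<close>,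
    right-continuity at \<open>S\<close> controls it: for large \<open>n\<close> the time
    \<open>T n + d k\<close> lies strictly between \<open>S\<close> and \<open>r\<close>, where
    \<open>X\<close> is within \<open>e / 2\<close> of its value at \<open>S\<close>.\<close>
  have VX: "(\<lambda>k. V (d k) \<omega>) \<longlonglongrightarrow> X (S \<omega>) \<omega>" if w: "\<omega> \<in> space Px" for \<omega>
  proof (rule LIMSEQ_I)
    fix e :: real assume e: "0 < e"
    have "((\<lambda>t. X t \<omega>) \<longlongrightarrow> X (S \<omega>) \<omega>) (at_right (S \<omega>))"
      using X_right_continuous[OF w S0] by (simp add: continuous_within)
    then have "eventually (\<lambda>t. dist (X t \<omega>) (X (S \<omega>) \<omega>) < e / 2) (at_right (S \<omega>))"
      using e by (intro tendstoD) auto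
    then obtain r where r: "S \<omega> < r" "\<And>t. S \<omega> < t \<Longrightarrow> t < r \<Longrightarrow> dist (X t \<omega>) (X (S \<omega>) \<omega>) < e / 2"
      by (auto simp: eventually_at_right_field)
    have "eventually (\<lambda>k. d k < r - S \<omega>) sequentially"
      using d_lim r(1) by (intro order_tendstoD(2)) auto
    then obtain N where N: "\<And>k. N \<le> k \<Longrightarrow> d k < r - S \<omega>"
      by (auto simp: eventually_sequentially)
    show "\<exists>N. \<forall>k\<ge>N. norm (V (d k) \<omega> - X (S \<omega>) \<omega>) < e"
    proof (intro exI[of _ N] allI impI)
      fix k assume k: "N \<le> k"
      have "(\<lambda>n. T n \<omega> + d k) \<longlonglongrightarrow> S \<omega> + d k" by (intro tendsto_add T_lim[OF w] tendsto_const)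
      then have T_gt: "eventually (\<lambda>n. S \<omega> < T n \<omega> + d k) sequentially"
        by (rule order_tendstoD(1)) (simp add: d_pos)
      have "T n \<omega> \<le> S \<omega>" for n
        using T_less[OF w, of n] T_zero[OF w, of n] S0[of \<omega>] by (cases "S \<omega> = 0") auto
      then have Tr: "T n \<omega> + d k < r" for n using N[OF k] by (smt (verit))
      from T_gt have ev: "eventually (\<lambda>n. dist (X (T n \<omega> + d k) \<omega>) (X (S \<omega>) \<omega>) \<le> e / 2) sequentially"
      proof eventually_elim
        case (elim n)
        then show ?case by (intro less_imp_le r(2) Tr)
      qed
      have "(\<lambda>n. dist (X (T n \<omega> + d k) \<omega>) (X (S \<omega>) \<omega>)) \<longlonglongrightarrow> dist (V (d k) \<omega>) (X (S \<omega>) \<omega>)"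
        by (intro tendsto_dist V_lim[OF w] less_imp_le[OF d_pos] tendsto_const)
      from tendsto_upperbound[OF this ev sequentially_bot]
      show "norm (V (d k) \<omega> - X (S \<omega>) \<omega>) < e" using e by (simp add: dist_norm)
    qed
  qed
  define L where "L = V 0"
  have mL: "L \<in> borel_measurable Px" unfolding L_def by (rule mV) simp
  have L_lim: "(\<lambda>n. X (T n \<omega>) \<omega>) \<longlonglongrightarrow> L \<omega>" if "\<omega> \<in> space Px" for \<omega>
    using V_lim[OF that order_refl] by (simp add: L_def)
  have mX: "(\<lambda>\<omega>. X (S \<omega>) \<omega>) \<in> borel_measurable Px"
    using X_sample_measurable'[OF stS S0 order_refl] by simp
  have mT: "(\<lambda>\<omega>. X (T n \<omega>) \<omega>) \<in> borel_measurable Px" for n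
    using X_sample_measurable'[OF stT T0 order_refl, of n] by simp

  have key: "expectation (\<lambda>\<omega>. h (L \<omega>) * g (X (S \<omega>) \<omega>)) = expectation (\<lambda>\<omega>. h (L \<omega>) * g (L \<omega>))"
    if g: "g \<in> C0" and hc: "continuous_on UNIV h" and hB: "\<And>y. \<bar>h y\<bar> \<le> B"
      and sm: "\<And>n t. 0 \<le> t \<Longrightarrow> expectation (\<lambda>\<omega>. h (X (T n \<omega>) \<omega>) * g (X (T n \<omega> + t) \<omega>)) =
        expectation (\<lambda>\<omega>. h (X (T n \<omega>) \<omega>) * transition_op P X t g (X (T n \<omega>) \<omega>))" for g h B
  proof -
    obtain C where C: "\<And>y. \<bar>g y\<bar> \<le> C" by (rule C0_bounded[OF g]) blast
    have hm: "h \<in> borel_measurable borel" by (rule borel_measurable_continuous_onI[OF hc])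
    have gm: "g \<in> borel_measurable borel" by (rule C0_measurable[OF g])
    have hl: "((\<lambda>n. h (s n)) \<longlongrightarrow> h l) sequentially" if "s \<longlonglongrightarrow> l" for s l
      using continuous_on_tendsto_compose[OF hc that] by simp
    have B0: "0 \<le> B" using hB[of 0] by linarith
    have bd: "\<bar>u * v\<bar> \<le> B * C" if "\<bar>u\<bar> \<le> B" "\<bar>v\<bar> \<le> C" for u v
      unfolding abs_mult using that B0 by (intro mult_mono) auto
    \<comment> \<open>First limit: \<open>n\<close> to infinity with the lag \<open>t\<close> fixed.
      The right-hand side converges because the transition operator maps \<open>g\<close> to a
      continuous function.\<close>
    have eqV: "expectation (\<lambda>\<omega>. h (L \<omega>) * g (V t \<omega>)) =
        expectation (\<lambda>\<omega>. h (L \<omega>) * transition_op P X t g (L \<omega>))" if t: "0 \<le> t" for t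
    proof -
      let ?Q = "transition_op P X t g"
      have Q: "?Q \<in> C0" by (rule feller_C0[OF g t])
      have "(\<lambda>n. expectation (\<lambda>\<omega>. h (X (T n \<omega>) \<omega>) * g (X (T n \<omega> + t) \<omega>)))
          \<longlonglongrightarrow> expectation (\<lambda>\<omega>. h (L \<omega>) * g (V t \<omega>))"
      proof (rule bounded_convergence)
        show "(\<lambda>\<omega>. h (X (T n \<omega>) \<omega>) * g (X (T n \<omega> + t) \<omega>)) \<in> borel_measurable Px" for n
          by (intro borel_measurable_times measurable_compose[OF mT hm] C0_sample(1)[OF stT T0 g t])
        show "\<bar>h (X (T n \<omega>) \<omega>) * g (X (T n \<omega> + t) \<omega>)\<bar> \<le> B * C" for n \<omega> by (intro bd hB C)
        show "(\<lambda>n. h (X (T n \<omega>) \<omega>) * g (X (T n \<omega> + t) \<omega>)) \<longlonglongrightarrow> h (L \<omega>) * g (V t \<omega>)"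
          if "\<omega> \<in> space Px" for \<omega>
          by (intro tendsto_mult hl L_lim that tendsto_C0[OF g] V_lim t)
      qed
      moreover have "(\<lambda>n. expectation (\<lambda>\<omega>. h (X (T n \<omega>) \<omega>) * ?Q (X (T n \<omega>) \<omega>)))
          \<longlonglongrightarrow> expectation (\<lambda>\<omega>. h (L \<omega>) * ?Q (L \<omega>))"
      proof (rule bounded_convergence)
        show "(\<lambda>\<omega>. h (X (T n \<omega>) \<omega>) * ?Q (X (T n \<omega>) \<omega>)) \<in> borel_measurable Px" for n
          by (intro borel_measurable_times measurable_compose[OF mT hm]
              measurable_compose[OF mT C0_measurable[OF Q]])
        show "\<bar>h (X (T n \<omega>) \<omega>) * ?Q (X (T n \<omega>) \<omega>)\<bar> \<le> B * C" for n \<omega>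
          by (intro bd hB transition_op_abs_le[OF gm C t])
        show "(\<lambda>n. h (X (T n \<omega>) \<omega>) * ?Q (X (T n \<omega>) \<omega>)) \<longlonglongrightarrow> h (L \<omega>) * ?Q (L \<omega>)"
          if "\<omega> \<in> space Px" for \<omega>
          by (intro tendsto_mult hl L_lim that tendsto_C0[OF Q])
      qed
      ultimately show ?thesis unfolding sm[OF t] by (rule LIMSEQ_unique)
    qed
    have d0: "0 \<le> d k" for k using d_pos[of k] by simp
    \<comment> \<open>Second limit: the lag \<open>d k\<close> tends to 0. The left-hand side uses
      \<open>VX\<close>, the right-hand side the pointwise convergence of the semigroup to the
      identity.\<close>
    have "(\<lambda>k. expectation (\<lambda>\<omega>. h (L \<omega>) * g (V (d k) \<omega>)))
        \<longlonglongrightarrow> expectation (\<lambda>\<omega>. h (L \<omega>) * g (X (S \<omega>) \<omega>))"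
    proof (rule bounded_convergence)
      show "(\<lambda>\<omega>. h (L \<omega>) * g (V (d k) \<omega>)) \<in> borel_measurable Px" for k
        by (intro borel_measurable_times measurable_compose[OF mL hm]
            measurable_compose[OF mV[OF d0] gm])
      show "\<bar>h (L \<omega>) * g (V (d k) \<omega>)\<bar> \<le> B * C" for k \<omega> by (intro bd hB C)
      show "(\<lambda>k. h (L \<omega>) * g (V (d k) \<omega>)) \<longlonglongrightarrow> h (L \<omega>) * g (X (S \<omega>) \<omega>)"
        if "\<omega> \<in> space Px" for \<omega>
        by (intro tendsto_mult tendsto_const tendsto_C0[OF g] VX that)
    qed
    moreover have "(\<lambda>k. expectation (\<lambda>\<omega>. h (L \<omega>) * transition_op P X (d k) g (L \<omega>)))
        \<longlonglongrightarrow> expectation (\<lambda>\<omega>. h (L \<omega>) * g (L \<omega>))"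
    proof (rule bounded_convergence)
      show "(\<lambda>\<omega>. h (L \<omega>) * transition_op P X (d k) g (L \<omega>)) \<in> borel_measurable Px" for k
        by (intro borel_measurable_times measurable_compose[OF mL hm]
            measurable_compose[OF mL C0_measurable[OF feller_C0[OF g d0]]])
      show "\<bar>h (L \<omega>) * transition_op P X (d k) g (L \<omega>)\<bar> \<le> B * C" for k \<omega>
        by (intro bd hB transition_op_abs_le[OF gm C d0])
      have "filterlim d (at_right 0) sequentially"
        unfolding filterlim_at using d_lim d_pos by (simp add: less_imp_neq[symmetric])
      from filterlim_compose[OF feller_lim[OF g] this]
      show "(\<lambda>k. h (L \<omega>) * transition_op P X (d k) g (L \<omega>)) \<longlonglongrightarrow> h (L \<omega>) * g (L \<omega>)"
        for \<omega>
        by (intro tendsto_mult tendsto_const)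
    qed
    ultimately show ?thesis unfolding eqV[OF d0] by (rule LIMSEQ_unique)
  qed

  have AE_eq: "AE \<omega> in Px. h (L \<omega>) = h (X (S \<omega>) \<omega>)" if h: "h \<in> C0" for h
  proof -
    obtain B where B: "\<And>y. \<bar>h y\<bar> \<le> B" by (rule C0_bounded[OF h]) blast
    have h2: "(\<lambda>y. (h y)\<^sup>2) \<in> C0" by (rule C0_power2[OF h])
    have hm: "h \<in> borel_measurable borel" by (rule C0_measurable[OF h])
    have mhL[measurable]: "(\<lambda>\<omega>. h (L \<omega>)) \<in> borel_measurable Px" by (rule measurable_compose[OF mL hm])
    have mhX[measurable]: "(\<lambda>\<omega>. h (X (S \<omega>) \<omega>)) \<in> borel_measurable Px" by (rule measurable_compose[OF mX hm])
    have bd: "\<bar>h y * h z\<bar> \<le> B * B" for y z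
      unfolding abs_mult using order_trans[OF abs_ge_zero B] by (intro mult_mono B) auto
    have i: "integrable Px (\<lambda>\<omega>. h (L \<omega>) * h (L \<omega>))" "integrable Px (\<lambda>\<omega>. h (L \<omega>) * h (X (S \<omega>) \<omega>))"
      "integrable Px (\<lambda>\<omega>. h (X (S \<omega>) \<omega>) * h (X (S \<omega>) \<omega>))"
      by (rule integrable_const_bound[of _ "B * B"], rule AE_I2, simp only: real_norm_def bd, measurable)+
    have 1: "expectation (\<lambda>\<omega>. h (L \<omega>) * h (X (S \<omega>) \<omega>)) = expectation (\<lambda>\<omega>. h (L \<omega>) * h (L \<omega>))"
      by (rule key[OF h C0_continuous[OF h] B]) (rule strong_markov_expectation_mult[OF stT T0 h h])
    \<comment> \<open>With the constant factor 1 and the square of \<open>h\<close> as test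
      function, the second moments of \<open>h L\<close> and \<open>h (X S)\<close> agree; line
      \<open>1\<close> above settles the mixed term.\<close>
    have "expectation (\<lambda>\<omega>. 1 * (h (X (S \<omega>) \<omega>))\<^sup>2) = expectation (\<lambda>\<omega>. 1 * (h (L \<omega>))\<^sup>2)"
      by (rule key[OF h2, of "\<lambda>_. 1" 1]) (use strong_markov_expectation[OF stT T0 h2] in auto)
    then have 2: "expectation (\<lambda>\<omega>. h (X (S \<omega>) \<omega>) * h (X (S \<omega>) \<omega>)) = expectation (\<lambda>\<omega>. h (L \<omega>) * h (L \<omega>))"
      by (simp add: power2_eq_square)
    have sq: "(h (L \<omega>) - h (X (S \<omega>) \<omega>))\<^sup>2 = h (L \<omega>) * h (L \<omega>) - 2 * (h (L \<omega>) * h (X (S \<omega>) \<omega>))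
        + h (X (S \<omega>) \<omega>) * h (X (S \<omega>) \<omega>)" for \<omega>
      by (simp add: power2_eq_square algebra_simps)
    have isq: "integrable Px (\<lambda>\<omega>. (h (L \<omega>) - h (X (S \<omega>) \<omega>))\<^sup>2)"
      unfolding sq by (intro Bochner_Integration.integrable_add Bochner_Integration.integrable_diff
          integrable_mult_right i)
    have "expectation (\<lambda>\<omega>. (h (L \<omega>) - h (X (S \<omega>) \<omega>))\<^sup>2) = 0"
      unfolding sq using i 1 2 by simp
    then have "AE \<omega> in Px. (h (L \<omega>) - h (X (S \<omega>) \<omega>))\<^sup>2 = 0"
      by (subst (asm) integral_nonneg_eq_0_iff_AE[OF isq]) simp_all
    then show ?thesis by eventually_elim simp
  qed
  have "AE \<omega> in Px. X (S \<omega>) \<omega> = L \<omega>"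
    using AE_eq[OF separating_C0(1)] AE_eq[OF separating_C0(2)]
    by eventually_elim (rule separating_C0_inj[symmetric])
  then show ?thesis
    by (rule AE_mp) (rule AE_I2, simp add: L_def V_def S_hit)
qed

end

text \<open>This is the form in which total inaccessibility of a jump time enters: it avoids every
  first zero, since there a positive first zero would carry a jump of \<open>X\<close>.\<close>

lemma jump_time_neq_hit:
  assumes Y: "cont_adapted Y" and b: "0 \<le> b" and Yb: "\<And>\<omega>. \<omega> \<in> space Px \<Longrightarrow> Y b \<omega> = 0"
    and \<tau>: "jump_time Px Fx X \<tau>"
  shows "AE \<omega> in Px. \<tau> \<omega> \<noteq> ennreal (hit Y 0 \<omega>)"
proof -
  have 1: "AE \<omega> in Px. 0 < \<tau> \<omega>" and 2: "AE \<omega> in Px. \<tau> \<omega> < \<infinity> \<longrightarrow>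
        X (enn2real (\<tau> \<omega>)) \<omega> \<noteq> Lim (at_left (enn2real (\<tau> \<omega>))) (\<lambda>t. X t \<omega>)"
    using \<tau> unfolding jump_time_def by blast+
  have "AE \<omega> in Px. 0 < hit Y 0 \<omega> \<longrightarrow>
     X (hit Y 0 \<omega>) \<omega> = Lim (at_left (hit Y 0 \<omega>)) (\<lambda>t. X t \<omega>)"
    by (rule quasi_left_continuous[OF Y b]) (rule Yb)
  with 1 2 show ?thesis
    by eventually_elim (auto simp: ennreal_zero_less_top)
qed

end

section \<open>Time change by the compensator\<close>

context filtered_prob_space begin

lemma predictable_rectsI:
  "B \<in> sets (F 0) \<Longrightarrow> {0} \<times> B \<in> predictable_rects"
  "0 \<le> s \<Longrightarrow> s \<le> t \<Longrightarrow> B \<in> sets (F (ennreal s)) \<Longrightarrow> {s<..t} \<times> B \<in> predictable_rects"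
  unfolding predictable_rects_def by blast+

lemma predictable_rects_sets:
  "D \<in> predictable_rects \<Longrightarrow> D \<in> sets (predictable_sigma (space M) F)"
  unfolding sets_predictable_sigma by (rule sigma_sets.Basic)

lemma space_Pred: "space (predictable_sigma (space M) F) = {0..} \<times> space M"
  using predictable_rects_Pow unfolding predictable_sigma_def predictable_rects_def
  by (rule space_measure_of)

lemma tail_predictable:
  assumes "0 \<le> s" "B \<in> sets (F (ennreal s))"
  shows "{s<..} \<times> B \<in> sets (predictable_sigma (space M) F)"
proof -
  have "{s<..} \<times> B = (\<Union>n. {s<..s + real n} \<times> B)"
  proof (rule set_eqI, rule iffI)
    fix p assume p: "p \<in> {s<..} \<times> B"
    obtain n where "fst p - s \<le> real n" using real_arch_simple by blast
    then have "p \<in> {s<..s + real n} \<times> B" using p by auto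
    then show "p \<in> (\<Union>n. {s<..s + real n} \<times> B)" by blast
  qed auto
  also have "\<dots> \<in> sets (predictable_sigma (space M) F)"
    by (intro sets.countable_UN image_subsetI predictable_rects_sets predictable_rectsI assms) simp
  finally show ?thesis .
qed

text \<open>A zero set inside \<open>D\<close> inherits the isolation from the left. Each of its
  points is therefore the first zero after some rational time, and \<open>T\<close> almost surely
  avoids these countably many first zeros. Inner regularity extends this to
  \<open>D\<close>.\<close>

lemma thin_predictable_null:
  assumes T: "T \<in> borel_measurable M" and T0: "\<And>\<omega>. \<omega> \<in> space M \<Longrightarrow> 0 \<le> T \<omega>"
    and D: "D \<in> sets (predictable_sigma (space M) F)"
    and isolated: "\<And>t \<omega>. (t, \<omega>) \<in> D \<Longrightarrow> \<exists>q\<ge>0. q < t \<and> (\<forall>s. q \<le> s \<and> s < t \<longrightarrow> (s, \<omega>) \<notin> D)"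
    and avoid: "\<And>Y b. cont_adapted Y \<Longrightarrow> 0 \<le> b \<Longrightarrow> (\<And>\<omega>. \<omega> \<in> space M \<Longrightarrow> Y b \<omega> = 0) \<Longrightarrow>
      AE \<omega> in M. T \<omega> \<noteq> hit Y 0 \<omega>"
  shows "AE \<omega> in M. (T \<omega>, \<omega>) \<notin> D"
proof -
  have reg: "inner_regular_at T D"
    by (rule inner_regular_at_predictable[OF T T0 D])
  have zeros_null: "prob (graph_event T (zeros Y)) = 0" if Y: "cont_adapted Y" and YD: "zeros Y \<subseteq> D" for Y
  proof -
    \<comment> \<open>The summand \<open>max 0 (q - t)\<close> removes the zeros of \<open>Y\<close>
      before \<open>q\<close>; the minimum with \<open>max 0 (real n - t)\<close> forces a zero at
      time \<open>n\<close>, so that the first zero exists on every path.\<close>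
    define Z where "Z q n = (\<lambda>t \<omega>. min (Y t \<omega> + max 0 (q - t)) (max 0 (real n - t)))" for q n
    have Z: "cont_adapted (Z q n)" for q n
    proof (rule cont_adaptedI)
      show "Z q n t \<in> borel_measurable (F (ennreal t))" if "0 \<le> t" for t
        unfolding Z_def
        by (intro borel_measurable_min borel_measurable_add borel_measurable_const cont_adaptedD(1)[OF Y that])
      show "continuous_on {0..} (\<lambda>t. Z q n t \<omega>)" if "\<omega> \<in> space M" for \<omega>
        unfolding Z_def by (intro continuous_intros cont_adaptedD(2)[OF Y that])
      show "0 \<le> Z q n t \<omega>" if "\<omega> \<in> space M" "0 \<le> t" for \<omega> t
        unfolding Z_def using cont_adaptedD(3)[OF Y that] by simp
    qed
    have "AE \<omega> in M. T \<omega> \<noteq> hit (Z q n) 0 \<omega>" for q n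
      by (rule avoid[OF Z, of "real n"]) (auto simp: Z_def dest: cont_adaptedD(3)[OF Y, of _ "real n"])
    then have "AE \<omega> in M. \<forall>n. \<forall>q\<in>\<rat>. T \<omega> \<noteq> hit (Z q n) 0 \<omega>"
      by (intro AE_all_countable[THEN iffD2] allI AE_ball_countable[OF countable_rat, THEN iffD2] ballI)
    then have "AE \<omega> in M. \<omega> \<notin> graph_event T (zeros Y)"
    proof (rule AE_mp, intro AE_I2 impI notI)
      fix \<omega> assume w: "\<omega> \<in> space M" and neq: "\<forall>n. \<forall>q\<in>\<rat>. T \<omega> \<noteq> hit (Z q n) 0 \<omega>"
        and "\<omega> \<in> graph_event T (zeros Y)"
      then have tz: "0 \<le> T \<omega>" "Y (T \<omega>) \<omega> = 0" "(T \<omega>, \<omega>) \<in> zeros Y"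
        by (auto simp: graph_event_def zeros_def)
      obtain p where p: "0 \<le> p" "p < T \<omega>" "\<And>s. p \<le> s \<Longrightarrow> s < T \<omega> \<Longrightarrow> (s, \<omega>) \<notin> D"
        using isolated[of "T \<omega>" \<omega>] tz(3) YD by blast
      obtain q where q: "q \<in> \<rat>" "p < q" "q < T \<omega>" using Rats_dense_in_real[OF p(2)] by blast
      obtain n where n: "T \<omega> < real n" using reals_Archimedean2 by blast
      have "hit (Z q n) 0 \<omega> = T \<omega>"
        unfolding hit_def
      proof (rule cInf_eq_minimum)
        show "T \<omega> \<in> {t. 0 \<le> t \<and> Z q n t \<omega> \<le> 0}"
          using tz q n by (simp add: Z_def)
        fix s assume "s \<in> {t. 0 \<le> t \<and> Z q n t \<omega> \<le> 0}"
        then have s: "0 \<le> s" "Z q n s \<omega> \<le> 0" by auto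
        show "T \<omega> \<le> s"
        proof (rule ccontr)
          assume "\<not> T \<omega> \<le> s"
          then have "s < T \<omega>" "0 < max 0 (real n - s)" using n by auto
          then have "Y s \<omega> + max 0 (q - s) \<le> 0" using s(2) unfolding Z_def by (auto simp only: min_le_iff_disj)
          then have "Y s \<omega> = 0" "q \<le> s" using cont_adaptedD(3)[OF Y w s(1)] by (auto simp: max_def split: if_splits)
          then have "(s, \<omega>) \<in> D" using YD s(1) w by (auto simp: zeros_def)
          then show False using p(3)[of s] q \<open>q \<le> s\<close> \<open>s < T \<omega>\<close> by simp
        qed
      qed
      then show False using neq q(1) by metis
    qed
    then show ?thesis
      by (subst prob_eq_0[OF graph_event_zeros[OF T T0 Y]])
  qed
  have ev: "graph_event T D \<in> events" using reg by (simp add: inner_regular_at_def)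
  have "prob (graph_event T D) \<le> 0"
  proof (rule field_le_epsilon)
    fix e :: real assume "0 < e"
    then obtain Y where Y: "cont_adapted Y" "zeros Y \<subseteq> D"
      "prob (graph_event T D - graph_event T (zeros Y)) < e"
      using reg unfolding inner_regular_at_def by blast
    have "prob (graph_event T D) \<le> prob ((graph_event T D - graph_event T (zeros Y)) \<union> graph_event T (zeros Y))"
      using ev graph_event_zeros[OF T T0 Y(1)] by (intro finite_measure_mono) auto
    also have "\<dots> \<le> prob (graph_event T D - graph_event T (zeros Y)) + prob (graph_event T (zeros Y))"
      using ev graph_event_zeros[OF T T0 Y(1)] by (intro measure_Un_le) auto
    finally show "prob (graph_event T D) \<le> 0 + e" using Y(3) zeros_null[OF Y(1,2)] by simp
  qed
  then have "prob (graph_event T D) = 0" using measure_nonneg[of M "graph_event T D"] by linarith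
  then have "AE \<omega> in M. \<omega> \<notin> graph_event T D" by (subst (asm) prob_eq_0[OF ev])
  then show ?thesis by (rule AE_mp) (auto simp: graph_event_def intro: AE_I2)
qed

end

text \<open>A regularized setting, supplied by \<open>compensated_time_of_compensator\<close>:
  \<open>T\<close> is finite, the path properties of \<open>A\<close> hold at every sample point,
  and the martingale property is integrated over predictable rectangles. Inaccessibility is stated
  for first zeros only.\<close>

locale compensated_time = filtered_prob_space +
  fixes T :: "'a \<Rightarrow> real" and A :: "real \<Rightarrow> 'a \<Rightarrow> real"
  assumes T0: "\<And>\<omega>. \<omega> \<in> space M \<Longrightarrow> 0 \<le> T \<omega>" and T_pos: "AE \<omega> in M. 0 < T \<omega>"
    and T_le: "\<And>t. 0 \<le> t \<Longrightarrow> {\<omega> \<in> space M. T \<omega> \<le> t} \<in> sets (F (ennreal t))"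
    and A_zero: "\<And>\<omega>. \<omega> \<in> space M \<Longrightarrow> A 0 \<omega> = 0"
    and A_mono: "\<And>\<omega> s t. \<omega> \<in> space M \<Longrightarrow> 0 \<le> s \<Longrightarrow> s \<le> t \<Longrightarrow> A s \<omega> \<le> A t \<omega>"
    and A_right: "\<And>\<omega> t. \<omega> \<in> space M \<Longrightarrow> 0 \<le> t \<Longrightarrow> continuous (at_right t) (\<lambda>t. A t \<omega>)"
    and A_measurable: "\<And>t. 0 \<le> t \<Longrightarrow> A t \<in> borel_measurable M"
    and A_predictable: "(\<lambda>(t, \<omega>). A t \<omega>) \<in> borel_measurable (predictable_sigma (space M) F)"
    and compensates: "\<And>s t B. 0 \<le> s \<Longrightarrow> s \<le> t \<Longrightarrow> B \<in> sets (F (ennreal s)) \<Longrightarrow>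
      emeasure M (B \<inter> {\<omega> \<in> space M. s < T \<omega> \<and> T \<omega> \<le> t}) =
      (\<integral>\<^sup>+\<omega>. ennreal (A t \<omega> - A s \<omega>) * indicator B \<omega> \<partial>M)"
    and inaccessible: "\<And>Y b. cont_adapted Y \<Longrightarrow> 0 \<le> b \<Longrightarrow> (\<And>\<omega>. \<omega> \<in> space M \<Longrightarrow> Y b \<omega> = 0) \<Longrightarrow>
      AE \<omega> in M. T \<omega> \<noteq> hit Y 0 \<omega>"
begin

abbreviation "Pred \<equiv> predictable_sigma (space M) F"

section \<open>Generalized inverse of the compensator\<close>

definition inv_A :: "'a \<Rightarrow> real \<Rightarrow> real" where
  "inv_A \<omega> u = Inf {t. 0 \<le> t \<and> u \<le> A t \<omega>}"

text \<open>Asking that the level be reached at a finite time makes the infimum in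
  \<open>inv_A\<close> run over a nonempty set; a supremum of \<open>A\<close> that is only
  approached is left out.\<close>

definition range_A :: "('a \<times> real) set" where
  "range_A = {(\<omega>, u). \<omega> \<in> space M \<and> 0 < u \<and> (\<exists>t\<ge>0. u \<le> A t \<omega>)}"

lemma T_measurable[measurable]: "T \<in> borel_measurable M"
proof (rule borel_measurableI_le)
  show "{\<omega> \<in> space M. T \<omega> \<le> t} \<in> sets M" for t
  proof (cases "0 \<le> t")
    case True
    then show ?thesis using T_le[OF True] F_le by blast
  next
    case False
    have "\<not> T \<omega> \<le> t" if "\<omega> \<in> space M" for \<omega> using T0[OF that] False by linarith
    then have "{\<omega> \<in> space M. T \<omega> \<le> t} = {}" by blast
    then show ?thesis by (simp only: sets.empty_sets)
  qed
qed

text \<open>Right-continuity makes the infimum a minimum, so \<open>inv_A\<close> and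
  \<open>A\<close> are adjoint: this is the third claim, on which all later computations of
  preimages rest. Positivity comes from \<open>A\<close> starting at 0.\<close>

lemma inv_A:
  assumes "(\<omega>, u) \<in> range_A"
  shows "0 < inv_A \<omega> u" "u \<le> A (inv_A \<omega> u) \<omega>" "\<And>t. 0 \<le> t \<Longrightarrow> inv_A \<omega> u \<le> t \<longleftrightarrow> u \<le> A t \<omega>"
proof -
  let ?S = "{t. 0 \<le> t \<and> u \<le> A t \<omega>}"
  have w: "\<omega> \<in> space M" and u: "0 < u" and ne: "?S \<noteq> {}" using assms by (auto simp: range_A_def)
  have bd: "bdd_below ?S" by (rule bdd_belowI[of _ 0]) auto
  have i0: "0 \<le> inv_A \<omega> u" unfolding inv_A_def by (rule cInf_greatest[OF ne]) auto
  show at: "u \<le> A (inv_A \<omega> u) \<omega>"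
  proof (rule ccontr)
    assume "\<not> u \<le> A (inv_A \<omega> u) \<omega>"
    then have lt: "A (inv_A \<omega> u) \<omega> < u" by simp
    have "((\<lambda>t. A t \<omega>) \<longlongrightarrow> A (inv_A \<omega> u) \<omega>) (at_right (inv_A \<omega> u))"
      using A_right[OF w i0] by (simp add: continuous_within)
    then have "eventually (\<lambda>t. A t \<omega> < u) (at_right (inv_A \<omega> u))"
      using lt by (rule order_tendstoD(2))
    then obtain r where r: "inv_A \<omega> u < r" "\<And>t. inv_A \<omega> u < t \<Longrightarrow> t < r \<Longrightarrow> A t \<omega> < u"
      by (auto simp: eventually_at_right_field)
    obtain t where t: "t \<in> ?S" "t < r"
      using cInf_lessD[OF ne] r(1) unfolding inv_A_def by blast
    have "inv_A \<omega> u \<le> t" unfolding inv_A_def by (rule cInf_lower[OF t(1) bd])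
    then show False using t r(2)[of t] lt by (cases "t = inv_A \<omega> u") auto
  qed
  show "0 < inv_A \<omega> u"
    using at u A_zero[OF w] i0 by (cases "inv_A \<omega> u = 0") auto
  show "inv_A \<omega> u \<le> t \<longleftrightarrow> u \<le> A t \<omega>" if t: "0 \<le> t" for t
  proof
    assume "inv_A \<omega> u \<le> t"
    then show "u \<le> A t \<omega>" using at A_mono[OF w i0] by fastforce
  next
    assume "u \<le> A t \<omega>"
    then show "inv_A \<omega> u \<le> t" unfolding inv_A_def by (intro cInf_lower[OF _ bd]) (simp add: t)
  qed
qed

section \<open>Jumps of the compensator\<close>

lemma shift_measurable: "0 \<le> d \<Longrightarrow> (\<lambda>(t, \<omega>). (max 0 (t - d), \<omega>)) \<in> measurable Pred Pred"
proof (rule measurable_sigma_sets[OF sets_predictable_sigma predictable_rects_Pow])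
  assume d: "0 \<le> d"
  show "(\<lambda>(t, \<omega>). (max 0 (t - d), \<omega>)) \<in> space Pred \<rightarrow> {0..} \<times> space M"
    by (auto simp: space_Pred)
  fix D :: "(real \<times> 'a) set" assume "D \<in> predictable_rects"
  then show "(\<lambda>(t, \<omega>). (max 0 (t - d), \<omega>)) -` D \<inter> space Pred \<in> sets Pred"
  proof (cases rule: predictable_rectsE)
    case (1 B)
    have "(\<lambda>(t, \<omega>). (max 0 (t - d), \<omega>)) -` D \<inter> space Pred = {0} \<times> B \<union> {0<..d} \<times> B"
      unfolding 1(2) space_Pred using F_sets_into_space[OF 1(1)] d by (auto simp: max_def split: if_splits)
    moreover have "{0} \<times> B \<in> sets Pred" "{0<..d} \<times> B \<in> sets Pred"
      using 1(1) d by (auto intro!: predictable_rects_sets predictable_rectsI)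
    ultimately show ?thesis by simp
  next
    case (2 s t B)
    \<comment> \<open>A set known at time \<open>s\<close> is still known at \<open>s + d\<close>;
      this is why delaying by \<open>d\<close> turns predictable rectangles into predictable
      rectangles.\<close>
    have "B \<in> sets (F (ennreal (s + d)))"
      using 2(1,3) d sets_F_mono[OF ennreal_leI[of s "s + d"]] by auto
    then have "{s + d<..t + d} \<times> B \<in> sets Pred"
      using 2(1,2) d by (intro predictable_rects_sets predictable_rectsI) simp_all
    moreover have "(\<lambda>(t, \<omega>). (max 0 (t - d), \<omega>)) -` D \<inter> space Pred = {s + d<..t + d} \<times> B"
      unfolding 2(4) space_Pred using F_sets_into_space[OF 2(3)] d 2(1) by (auto simp: max_def split: if_splits)
    ultimately show ?thesis by simp
  qed
qed

lemma A_shift_measurable: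
  assumes "0 \<le> d" shows "(\<lambda>(t, \<omega>). A (max 0 (t - d)) \<omega>) \<in> borel_measurable Pred"
  using measurable_compose[OF shift_measurable[OF assms] A_predictable] by (simp add: split_beta')

text \<open>Jumps of size at least \<open>1 / (k + 1)\<close>. By monotonicity countably many
  delayed copies of \<open>A\<close> replace the left limit, which makes predictability visible. At
  time 0 all copies agree, so 0 never counts as a jump.\<close>

definition jumps :: "nat \<Rightarrow> (real \<times> 'a) set" where
  "jumps k = {p \<in> space Pred. \<forall>n. 1 / real (Suc k) \<le>
     (case p of (t, \<omega>) \<Rightarrow> A t \<omega>) - (case p of (t, \<omega>) \<Rightarrow> A (max 0 (t - 1 / real (Suc n))) \<omega>)}"

lemma jumps_measurable: "jumps k \<in> sets Pred"
proof -
  have [measurable]: "(\<lambda>p. case p of (t, \<omega>) \<Rightarrow> A (max 0 (t - 1 / real (Suc n))) \<omega>) \<in> borel_measurable Pred" for n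
    using A_shift_measurable[of "1 / real (Suc n)"] by simp
  note A_predictable[measurable]
  show ?thesis unfolding jumps_def by measurable
qed

lemma jumps_le:
  assumes "(t, \<omega>) \<in> jumps k" "0 \<le> s" "s < t"
  shows "1 / real (Suc k) \<le> A t \<omega> - A s \<omega>"
proof -
  have w: "\<omega> \<in> space M" using assms(1) by (auto simp: jumps_def space_Pred)
  obtain n where n: "1 / real (Suc n) < t - s"
    using reals_Archimedean[of "t - s"] assms(3) by (auto simp: inverse_eq_divide)
  have "1 / real (Suc k) \<le> A t \<omega> - A (max 0 (t - 1 / real (Suc n))) \<omega>"
    using assms(1) by (simp add: jumps_def)
  moreover have "A s \<omega> \<le> A (max 0 (t - 1 / real (Suc n))) \<omega>"
    using n by (intro A_mono[OF w assms(2)]) linarith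
  ultimately show ?thesis by linarith
qed

text \<open>The jump set is isolated from the left: \<open>q\<close> is chosen so that
  \<open>A\<close> at \<open>q\<close> is within one jump size of its supremum before
  \<open>t\<close>. A jump strictly between \<open>q\<close> and \<open>t\<close> would push
  \<open>A\<close> above that supremum.\<close>

lemma AE_no_jump: "AE \<omega> in M. (T \<omega>, \<omega>) \<notin> jumps k"
proof (rule thin_predictable_null[OF T_measurable T0 jumps_measurable _ inaccessible])
  fix t \<omega> assume t: "(t, \<omega>) \<in> jumps k"
  have w: "\<omega> \<in> space M" and "0 \<le> t" using t by (auto simp: jumps_def space_Pred)
  have "t \<noteq> 0"
  proof
    assume "t = 0"
    then have "1 / real (Suc k) \<le> A 0 \<omega> - A 0 \<omega>" using t by (simp add: jumps_def)
    then show False by (simp del: of_nat_Suc)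
  qed
  with \<open>0 \<le> t\<close> have t0: "0 < t" by simp
  let ?I = "(\<lambda>s. A s \<omega>) ` {0..<t}"
  define e where "e = 1 / real (Suc k)"
  have e: "0 < e" by (simp add: e_def)
  have bd: "bdd_above ?I" by (rule bdd_aboveI2[of _ _ "A t \<omega>"]) (auto intro!: A_mono[OF w])
  have "Sup ?I - e < Sup ?I" using e by simp
  then obtain q where q: "0 \<le> q" "q < t" "Sup ?I - e < A q \<omega>"
    by (subst (asm) less_cSup_iff[OF _ bd]) (use t0 in auto)
  have "(s, \<omega>) \<notin> jumps k" if s: "q < s" "s < t" for s
  proof
    assume "(s, \<omega>) \<in> jumps k"
    from jumps_le[OF this q(1) s(1)] have "e \<le> A s \<omega> - A q \<omega>" by (simp add: e_def)
    moreover have "A s \<omega> \<le> Sup ?I" using q s by (intro cSup_upper[OF _ bd]) auto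
    ultimately show False using q(3) by linarith
  qed
  \<comment> \<open>The interval free of jumps has to include its left end, so a point strictly
    between \<open>q\<close> and \<open>t\<close> is taken.\<close>
  then show "\<exists>q\<ge>0. q < t \<and> (\<forall>s. q \<le> s \<and> s < t \<longrightarrow> (s, \<omega>) \<notin> jumps k)"
    using q dense[OF q(2)] by (metis dual_order.strict_trans1 less_eq_real_def order.trans)
qed

section \<open>Two measures on the predictable sigma-algebra\<close>

definition graph_law :: "(real \<times> 'a) measure" where
  "graph_law = distr M Pred (\<lambda>\<omega>. (T \<omega>, \<omega>))"

text \<open>This is the measure \<open>dA\<close> on each path, averaged over the sample space.
  Taking the image of Lebesgue measure under the generalized inverse replaces a Stieltjes measure
  for every path.\<close>

definition intensity :: "(real \<times> 'a) measure" where
  "intensity = distr (restrict_space (M \<Otimes>\<^sub>M lborel) range_A) Pred (\<lambda>(\<omega>, u). (inv_A \<omega> u, \<omega>))"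

lemma graph_measurable: "(\<lambda>\<omega>. (T \<omega>, \<omega>)) \<in> measurable M Pred"
proof (rule measurable_sigma_sets[OF sets_predictable_sigma predictable_rects_Pow])
  show "(\<lambda>\<omega>. (T \<omega>, \<omega>)) \<in> space M \<rightarrow> {0..} \<times> space M" using T0 by auto
  fix D :: "(real \<times> 'a) set" assume "D \<in> predictable_rects"
  then show "(\<lambda>\<omega>. (T \<omega>, \<omega>)) -` D \<inter> space M \<in> sets M"
  proof (cases rule: predictable_rectsE)
    case (1 B)
    have [measurable]: "B \<in> sets M" using 1(1) F_le by blast
    have "(\<lambda>\<omega>. (T \<omega>, \<omega>)) -` D \<inter> space M = {\<omega> \<in> space M. T \<omega> = 0 \<and> \<omega> \<in> B}" unfolding 1(2) by auto
    also have "\<dots> \<in> sets M" by measurable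
    finally show ?thesis .
  next
    case (2 s t B)
    have [measurable]: "B \<in> sets M" using 2(3) F_le by blast
    have "(\<lambda>\<omega>. (T \<omega>, \<omega>)) -` D \<inter> space M = {\<omega> \<in> space M. s < T \<omega> \<and> T \<omega> \<le> t \<and> \<omega> \<in> B}"
      unfolding 2(4) by auto
    also have "\<dots> \<in> sets M" by measurable
    finally show ?thesis .
  qed
qed

lemma range_A_measurable[measurable]: "range_A \<in> sets (M \<Otimes>\<^sub>M lborel)"
proof -
  have [measurable]: "A (real n) \<in> borel_measurable M" for n by (rule A_measurable) simp
  have "range_A = (\<Union>n. {p \<in> space (M \<Otimes>\<^sub>M lborel). 0 < snd p \<and> snd p \<le> A (real n) (fst p)})"
  proof (rule set_eqI, rule iffI)
    fix p assume "p \<in> range_A"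
    then obtain \<omega> u t where p: "p = (\<omega>, u)" "\<omega> \<in> space M" "0 < u" "0 \<le> t" "u \<le> A t \<omega>"
      by (auto simp: range_A_def)
    obtain n where "t \<le> real n" using real_arch_simple by blast
    then have "u \<le> A (real n) \<omega>" using A_mono[OF p(2,4)] p(5) by (meson order_trans)
    then show "p \<in> (\<Union>n. {p \<in> space (M \<Otimes>\<^sub>M lborel). 0 < snd p \<and> snd p \<le> A (real n) (fst p)})"
      using p by (auto simp: space_pair_measure)
  next
    fix p assume "p \<in> (\<Union>n. {p \<in> space (M \<Otimes>\<^sub>M lborel). 0 < snd p \<and> snd p \<le> A (real n) (fst p)})"
    then show "p \<in> range_A" by (auto simp: range_A_def space_pair_measure intro: of_nat_0_le_iff)
  qed
  also have "\<dots> \<in> sets (M \<Otimes>\<^sub>M lborel)" by measurable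
  finally show ?thesis .
qed

lemma space_range_A: "space (restrict_space (M \<Otimes>\<^sub>M lborel) range_A) = range_A"
  by (auto simp: space_restrict_space space_pair_measure range_A_def)

text \<open>By the adjointness of \<open>inv_A\<close> and \<open>A\<close>, a rectangle pulls back
  to a band between two values of \<open>A\<close>, whose section at a point of \<open>B\<close> has
  length \<open>A t - A s\<close>.\<close>

lemma inv_preimage:
  assumes "0 \<le> s" "s \<le> t" "B \<subseteq> space M"
  shows "(\<lambda>(\<omega>, u). (inv_A \<omega> u, \<omega>)) -` ({s<..t} \<times> B) \<inter> range_A =
    {p \<in> space (M \<Otimes>\<^sub>M lborel). fst p \<in> B \<and> A s (fst p) < snd p \<and> snd p \<le> A t (fst p)}"
proof (rule set_eqI, rule iffI)
  fix p
  assume "p \<in> (\<lambda>(\<omega>, u). (inv_A \<omega> u, \<omega>)) -` ({s<..t} \<times> B) \<inter> range_A"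
  then obtain \<omega> u where p: "p = (\<omega>, u)" and
    *: "(\<omega>, u) \<in> range_A" "s < inv_A \<omega> u" "inv_A \<omega> u \<le> t" "\<omega> \<in> B"
    by (cases p) auto
  have "A s \<omega> < u" "u \<le> A t \<omega>"
    using inv_A(3)[OF *(1), of s] inv_A(3)[OF *(1), of t] assms(1,2) *(2,3) by auto
  then show "p \<in> {p \<in> space (M \<Otimes>\<^sub>M lborel). fst p \<in> B \<and> A s (fst p) < snd p \<and> snd p \<le> A t (fst p)}"
    using p *(4) assms(3) by (auto simp: space_pair_measure)
next
  fix p
  assume "p \<in> {p \<in> space (M \<Otimes>\<^sub>M lborel). fst p \<in> B \<and> A s (fst p) < snd p \<and> snd p \<le> A t (fst p)}"
  then obtain \<omega> u where p: "p = (\<omega>, u)" and *: "\<omega> \<in> B" "A s \<omega> < u" "u \<le> A t \<omega>"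
    by (cases p) auto
  have w: "\<omega> \<in> space M" using *(1) assms(3) by blast
  have "0 \<le> A s \<omega>" using A_mono[OF w order_refl assms(1)] A_zero[OF w] by simp
  then have r: "(\<omega>, u) \<in> range_A" using * w assms(1,2) by (auto simp: range_A_def intro!: exI[of _ t])
  have "s < inv_A \<omega> u" "inv_A \<omega> u \<le> t"
    using inv_A(3)[OF r, of s] inv_A(3)[OF r, of t] assms(1,2) *(2,3) by auto
  then show "p \<in> (\<lambda>(\<omega>, u). (inv_A \<omega> u, \<omega>)) -` ({s<..t} \<times> B) \<inter> range_A"
    using p *(1) r by simp
qed

lemma band_measurable:
  assumes "0 \<le> s" "s \<le> t" "B \<in> sets M"
  shows "{p \<in> space (M \<Otimes>\<^sub>M lborel). fst p \<in> B \<and> A s (fst p) < snd p \<and> snd p \<le> A t (fst p)}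
    \<in> sets (M \<Otimes>\<^sub>M lborel)"
proof -
  have [measurable]: "A s \<in> borel_measurable M" "A t \<in> borel_measurable M" "B \<in> sets M"
    using assms by (auto intro: A_measurable)
  show ?thesis by measurable
qed

lemma zero_preimage: "(\<lambda>(\<omega>, u). (inv_A \<omega> u, \<omega>)) -` ({0} \<times> B) \<inter> range_A = {}"
  using inv_A(1) by fastforce

lemma inv_measurable:
  "(\<lambda>(\<omega>, u). (inv_A \<omega> u, \<omega>)) \<in> measurable (restrict_space (M \<Otimes>\<^sub>M lborel) range_A) Pred"
proof (rule measurable_sigma_sets[OF sets_predictable_sigma predictable_rects_Pow])
  show "(\<lambda>(\<omega>, u). (inv_A \<omega> u, \<omega>)) \<in> space (restrict_space (M \<Otimes>\<^sub>M lborel) range_A) \<rightarrow> {0..} \<times> space M"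
    unfolding space_range_A using inv_A(1) by (auto simp: range_A_def intro: less_imp_le)
  fix D :: "(real \<times> 'a) set" assume "D \<in> predictable_rects"
  then show "(\<lambda>(\<omega>, u). (inv_A \<omega> u, \<omega>)) -` D \<inter> space (restrict_space (M \<Otimes>\<^sub>M lborel) range_A)
      \<in> sets (restrict_space (M \<Otimes>\<^sub>M lborel) range_A)"
    unfolding space_range_A
  proof (cases rule: predictable_rectsE)
    case (1 B)
    then show "(\<lambda>(\<omega>, u). (inv_A \<omega> u, \<omega>)) -` D \<inter> range_A
      \<in> sets (restrict_space (M \<Otimes>\<^sub>M lborel) range_A)" using zero_preimage by simp
  next
    case (2 s t B)
    have "B \<in> sets M" using 2(3) F_le by blast
    from band_measurable[OF 2(1,2) this]
    have "(\<lambda>(\<omega>, u). (inv_A \<omega> u, \<omega>)) -` D \<inter> range_A \<in> sets (M \<Otimes>\<^sub>M lborel)"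
      unfolding 2(4) inv_preimage[OF 2(1,2) F_sets_into_space[OF 2(3)]] .
    then show "(\<lambda>(\<omega>, u). (inv_A \<omega> u, \<omega>)) -` D \<inter> range_A
      \<in> sets (restrict_space (M \<Otimes>\<^sub>M lborel) range_A)"
      using sets.Int[OF range_A_measurable sets.top]
      by (subst sets_restrict_space_iff) auto
  qed
qed


lemma Int_stable_predictable_rects: "Int_stable predictable_rects"
proof (rule Int_stableI)
  fix D E assume "D \<in> predictable_rects" "E \<in> predictable_rects"
  then show "D \<inter> E \<in> predictable_rects"
  proof (elim predictable_rectsE)
    fix B C assume *: "B \<in> sets (F 0)" "D = {0} \<times> B" "C \<in> sets (F 0)" "E = {0} \<times> C"
    have "D \<inter> E = {0} \<times> (B \<inter> C)" using * by auto
    then show ?thesis using * by (simp only:) (intro predictable_rectsI sets.Int)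
  next
    fix B s t C
    assume *: "B \<in> sets (F 0)" "D = {0} \<times> B" "0 \<le> s" "s \<le> t" "E = {s<..t} \<times> C"
    have "D \<inter> E = {0} \<times> {}" using * by auto
    then show ?thesis by (simp only:) (intro predictable_rectsI sets.empty_sets)
  next
    fix B s t C
    assume *: "B \<in> sets (F 0)" "E = {0} \<times> B" "0 \<le> s" "s \<le> t" "D = {s<..t} \<times> C"
    have "D \<inter> E = {0} \<times> {}" using * by auto
    then show ?thesis by (simp only:) (intro predictable_rectsI sets.empty_sets)
  next
    fix s t B s' t' C
    assume *: "0 \<le> s" "s \<le> t" "B \<in> sets (F (ennreal s))" "D = {s<..t} \<times> B"
      "0 \<le> s'" "s' \<le> t'" "C \<in> sets (F (ennreal s'))" "E = {s'<..t'} \<times> C"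
    \<comment> \<open>The outer maximum in the upper end keeps it at least the lower end when the
      two intervals are disjoint; the rectangle is then empty but still of the required
      form.\<close>
    have "D \<inter> E = {max s s'<..max (max s s') (min t t')} \<times> (B \<inter> C)"
      using * by auto
    moreover have "B \<in> sets (F (ennreal (max s s')))" "C \<in> sets (F (ennreal (max s s')))"
      using *(3,7) sets_F_mono[OF ennreal_leI[of s "max s s'"]] sets_F_mono[OF ennreal_leI[of s' "max s s'"]]
      by auto
    ultimately show ?thesis
      using *(1) by (simp only:) (intro predictable_rectsI sets.Int; simp)
  qed
qed

lemma emeasure_intensity:
  assumes D: "D \<in> sets Pred"
  shows "emeasure intensity D =
    emeasure (M \<Otimes>\<^sub>M lborel) ((\<lambda>(\<omega>, u). (inv_A \<omega> u, \<omega>)) -` D \<inter> range_A)"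
proof -
  have "emeasure intensity D = emeasure (restrict_space (M \<Otimes>\<^sub>M lborel) range_A)
      ((\<lambda>(\<omega>, u). (inv_A \<omega> u, \<omega>)) -` D \<inter> range_A)"
    unfolding intensity_def by (simp add: emeasure_distr[OF inv_measurable D] space_range_A)
  also have "\<dots> = emeasure (M \<Otimes>\<^sub>M lborel) ((\<lambda>(\<omega>, u). (inv_A \<omega> u, \<omega>)) -` D \<inter> range_A)"
    using sets.Int[OF range_A_measurable sets.top] by (intro emeasure_restrict_space) auto
  finally show ?thesis .
qed

text \<open>Uniqueness on an intersection-stable generator. On rectangles over
  \<open>{s<..t}\<close> equality is the martingale property; over time 0 both measures vanish,
  because \<open>T\<close> is almost surely positive and \<open>inv_A\<close> is positive.\<close>

lemma graph_law_eq_intensity: "graph_law = intensity"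
proof (rule measure_eqI_generator_eq[OF Int_stable_predictable_rects predictable_rects_Pow])
  show "sets graph_law = sigma_sets ({0..} \<times> space M) predictable_rects"
    "sets intensity = sigma_sets ({0..} \<times> space M) predictable_rects"
    by (simp_all add: graph_law_def intensity_def sets_predictable_sigma)
  define C where "C n = (case n of 0 \<Rightarrow> {0::real} \<times> space M | Suc n \<Rightarrow> {0<..real (Suc n)} \<times> space M)" for n
  show "range C \<subseteq> predictable_rects"
    by (auto simp: C_def F_sets_space split: nat.split intro!: predictable_rectsI)
  show "(\<Union>n. C n) = {0..} \<times> space M"
  proof (rule set_eqI, rule iffI)
    fix p assume "p \<in> (\<Union>n. C n)"
    then obtain n where "p \<in> C n" by blast
    then show "p \<in> {0..} \<times> space M" by (cases n) (auto simp: C_def)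
  next
    fix p assume "p \<in> {0::real..} \<times> space M"
    then obtain t \<omega> where p: "p = (t, \<omega>)" "0 \<le> t" "\<omega> \<in> space M" by auto
    obtain n where "t \<le> real n" using real_arch_simple by blast
    then have "p \<in> (if t = 0 then C 0 else C (Suc n))" using p by (auto simp: C_def)
    then show "p \<in> (\<Union>n. C n)" by (auto split: if_splits)
  qed
  interpret G: prob_space graph_law
    unfolding graph_law_def by (rule prob_space_distr[OF graph_measurable])
  show "emeasure graph_law (C n) \<noteq> \<infinity>" for n by simp
  fix D assume D: "D \<in> predictable_rects"
  then have DP: "D \<in> sets Pred" by (rule predictable_rects_sets)
  have G: "emeasure graph_law D = emeasure M ((\<lambda>\<omega>. (T \<omega>, \<omega>)) -` D \<inter> space M)"
    unfolding graph_law_def by (rule emeasure_distr[OF graph_measurable DP])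
  from D show "emeasure graph_law D = emeasure intensity D"
  proof (cases rule: predictable_rectsE)
    case (1 B)
    have "AE \<omega> in M. \<omega> \<notin> (\<lambda>\<omega>. (T \<omega>, \<omega>)) -` D \<inter> space M"
      using T_pos by eventually_elim (auto simp: 1(2))
    then have "emeasure graph_law D = 0"
      unfolding G using measurable_sets[OF graph_measurable DP]
      by (subst (asm) AE_iff_null_sets[symmetric]) auto
    moreover have "emeasure intensity D = 0"
      unfolding emeasure_intensity[OF DP] unfolding 1(2) zero_preimage by simp
    ultimately show ?thesis by simp
  next
    case (2 s t B)
    have B: "B \<in> sets M" using 2(3) F_le by blast
    have "(\<lambda>\<omega>. (T \<omega>, \<omega>)) -` D \<inter> space M = B \<inter> {\<omega> \<in> space M. s < T \<omega> \<and> T \<omega> \<le> t}"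
      unfolding 2(4) by auto
    then have "emeasure graph_law D = (\<integral>\<^sup>+\<omega>. ennreal (A t \<omega> - A s \<omega>) * indicator B \<omega> \<partial>M)"
      unfolding G by (simp only: compensates[OF 2(1-3)])
    also have "\<dots> = (\<integral>\<^sup>+\<omega>. emeasure lborel (Pair \<omega> -` {p \<in> space (M \<Otimes>\<^sub>M lborel).
        fst p \<in> B \<and> A s (fst p) < snd p \<and> snd p \<le> A t (fst p)}) \<partial>M)"
    proof (rule nn_integral_cong)
      fix \<omega> assume w: "\<omega> \<in> space M"
      have "Pair \<omega> -` {p \<in> space (M \<Otimes>\<^sub>M lborel). fst p \<in> B \<and> A s (fst p) < snd p \<and> snd p \<le> A t (fst p)}
          = (if \<omega> \<in> B then {A s \<omega><..A t \<omega>} else {})"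
        using w by (auto simp: space_pair_measure)
      then show "ennreal (A t \<omega> - A s \<omega>) * indicator B \<omega> =
        emeasure lborel (Pair \<omega> -` {p \<in> space (M \<Otimes>\<^sub>M lborel).
        fst p \<in> B \<and> A s (fst p) < snd p \<and> snd p \<le> A t (fst p)})"
        using A_mono[OF w 2(1,2)] by simp
    qed
    also have "\<dots> = emeasure intensity D"
      unfolding emeasure_intensity[OF DP]
      unfolding 2(4) inv_preimage[OF 2(1,2) F_sets_into_space[OF 2(3)]]
      by (rule lborel.emeasure_pair_measure_alt[symmetric, OF band_measurable[OF 2(1,2) B]])
    finally show ?thesis .
  qed
qed

text \<open>\<open>A\<close> at \<open>inv_A \<omega> u\<close> can exceed \<open>u\<close> only
  through a jump of \<open>A\<close>. The jump sets are null for \<open>graph_law\<close> by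
  inaccessibility, and equality of the two measures transfers this to
  \<open>intensity\<close>.\<close>

lemma AE_A_inv:
  "AE p in restrict_space (M \<Otimes>\<^sub>M lborel) range_A. A (inv_A (fst p) (snd p)) (fst p) = snd p"
proof -
  have "AE p in graph_law. p \<notin> jumps k" for k
    unfolding graph_law_def using AE_no_jump[of k]
    by (subst AE_distr_iff[OF graph_measurable]) (simp_all add: jumps_measurable sets.compl_sets
        Collect_neg_eq[symmetric] set_diff_eq[symmetric])
  then have "AE p in intensity. p \<notin> jumps k" for k
    unfolding graph_law_eq_intensity .
  then have "AE p in restrict_space (M \<Otimes>\<^sub>M lborel) range_A. (inv_A (fst p) (snd p), fst p) \<notin> jumps k" for k
    unfolding intensity_def
    by (subst (asm) AE_distr_iff[OF inv_measurable]) (simp_all add: jumps_measurable sets.compl_sets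
        set_diff_eq[symmetric] split_beta')
  then have "AE p in restrict_space (M \<Otimes>\<^sub>M lborel) range_A. \<forall>k. (inv_A (fst p) (snd p), fst p) \<notin> jumps k"
    by (intro AE_all_countable[THEN iffD2] allI)
  then show ?thesis
  proof (rule AE_mp, intro AE_I2 impI)
    fix p assume "p \<in> space (restrict_space (M \<Otimes>\<^sub>M lborel) range_A)"
      and nj: "\<forall>k. (inv_A (fst p) (snd p), fst p) \<notin> jumps k"
    then obtain \<omega> u where p: "p = (\<omega>, u)" and r: "(\<omega>, u) \<in> range_A"
      unfolding space_range_A by (cases p) auto
    let ?t = "inv_A \<omega> u"
    note i = inv_A[OF r]
    have w: "\<omega> \<in> space M" using r by (simp add: range_A_def)
    have "A ?t \<omega> \<le> u"
    proof (rule field_le_epsilon)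
      fix e :: real assume "0 < e"
      then obtain k where k: "1 / real (Suc k) < e"
        using reals_Archimedean[of e] by (auto simp: inverse_eq_divide)
      have "(?t, \<omega>) \<notin> jumps k" using nj p by simp
      \<comment> \<open>Without a jump of size \<open>1 / (k + 1)\<close> some earlier time has a
        value of \<open>A\<close> that close. This value is below \<open>u\<close>, since the time
        precedes \<open>inv_A \<omega> u\<close>.\<close>
      then obtain n where n: "A ?t \<omega> - A (max 0 (?t - 1 / real (Suc n))) \<omega> < 1 / real (Suc k)"
        using i(1) w unfolding jumps_def space_Pred by (auto simp: not_le simp del: of_nat_Suc)
      have "max 0 (?t - 1 / real (Suc n)) < ?t" using i(1) by simp
      then have "A (max 0 (?t - 1 / real (Suc n))) \<omega> < u"
        using i(3)[of "max 0 (?t - 1 / real (Suc n))"] by (simp only: max.cobounded1 not_le[symmetric]) simp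
      then show "A ?t \<omega> \<le> u + e" using n k by linarith
    qed
    then show "A (inv_A (fst p) (snd p)) (fst p) = snd p" using i(2) p by simp
  qed
qed

text \<open>The complement of this stochastic interval consists of the times after some rational
  \<open>q\<close> with \<open>T \<omega> \<le> q\<close>, a countable union of predictable
  sets.\<close>

lemma before_T_predictable: "{p \<in> space Pred. fst p \<le> T (snd p)} \<in> sets Pred"
proof -
  define R where "R = (\<Union>q\<in>\<rat> \<inter> {0..}. {q<..} \<times> {\<omega> \<in> space M. T \<omega> \<le> q})"
  have "countable (\<rat> \<inter> {0::real..})" by (simp add: countable_Int1 countable_rat)
  then have "R \<in> sets Pred"
    unfolding R_def by (intro sets.countable_UN' subsetI) (auto intro!: tail_predictable T_le)
  moreover have "{p \<in> space Pred. fst p \<le> T (snd p)} = space Pred - R"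
  proof (rule set_eqI, rule iffI)
    fix p assume "p \<in> {p \<in> space Pred. fst p \<le> T (snd p)}"
    then show "p \<in> space Pred - R" unfolding R_def by force
  next
    fix p assume p: "p \<in> space Pred - R"
    then have sp: "0 \<le> fst p" "snd p \<in> space M" by (auto simp: space_Pred)
    have "fst p \<le> T (snd p)"
    proof (rule ccontr)
      assume "\<not> fst p \<le> T (snd p)"
      then obtain q where q: "q \<in> \<rat>" "T (snd p) < q" "q < fst p"
        using Rats_dense_in_real[of "T (snd p)" "fst p"] by auto
      then have "p \<in> {q<..} \<times> {\<omega> \<in> space M. T \<omega> \<le> q}" "q \<in> \<rat> \<inter> {0..}"
        using sp T0[OF sp(2)] by (cases p; auto)+
      then show False using p unfolding R_def by blast
    qed
    then show "p \<in> {p \<in> space Pred. fst p \<le> T (snd p)}" using p by simp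
  qed
  ultimately show ?thesis by simp
qed

lemma A_T_measurable: "(\<lambda>\<omega>. A (T \<omega>) \<omega>) \<in> borel_measurable M"
  using measurable_compose[OF graph_measurable A_predictable] by simp

text \<open>The predictable integrand \<open>H\<close> is integrated against both measures. The
  cutoff \<open>t \<le> T\<close> is 1 on the graph of \<open>T\<close>; under the time change it
  becomes \<open>u \<le> A (T \<omega>) \<omega>\<close> by adjointness, while \<open>A\<close> at
  \<open>inv_A\<close> reduces to \<open>u\<close> almost everywhere.\<close>

lemma nn_integral_A_T:
  fixes f :: "real \<Rightarrow> ennreal"
  assumes f[measurable]: "f \<in> borel_measurable borel"
  shows "(\<integral>\<^sup>+\<omega>. f (A (T \<omega>) \<omega>) \<partial>M) =
    (\<integral>\<^sup>+\<omega>. (\<integral>\<^sup>+u. f u * indicator {0<..A (T \<omega>) \<omega>} u \<partial>lborel) \<partial>M)"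
proof -
  define H where "H p = f (case p of (t, \<omega>) \<Rightarrow> A t \<omega>) * indicator {p \<in> space Pred. fst p \<le> T (snd p)} p"
    for p
  note A_predictable[measurable] A_T_measurable[measurable] before_T_predictable[measurable]
  have H: "H \<in> borel_measurable Pred" unfolding H_def by measurable
  have "(\<integral>\<^sup>+\<omega>. f (A (T \<omega>) \<omega>) \<partial>M) = (\<integral>\<^sup>+\<omega>. H (T \<omega>, \<omega>) \<partial>M)"
    by (rule nn_integral_cong) (simp add: H_def space_Pred T0)
  also have "\<dots> = (\<integral>\<^sup>+p. H p \<partial>graph_law)"
    unfolding graph_law_def by (rule nn_integral_distr[symmetric, OF graph_measurable]) (simp add: H)
  also have "\<dots> = (\<integral>\<^sup>+p. H (case p of (\<omega>, u) \<Rightarrow> (inv_A \<omega> u, \<omega>)) \<partial>restrict_space (M \<Otimes>\<^sub>M lborel) range_A)"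
    unfolding graph_law_eq_intensity intensity_def by (rule nn_integral_distr[OF inv_measurable]) (simp add: H)
  also have "\<dots> = (\<integral>\<^sup>+p. f (snd p) * indicator {p. snd p \<le> A (T (fst p)) (fst p)} p
      \<partial>restrict_space (M \<Otimes>\<^sub>M lborel) range_A)"
  proof (rule nn_integral_cong_AE)
    show "AE p in restrict_space (M \<Otimes>\<^sub>M lborel) range_A. H (case p of (\<omega>, u) \<Rightarrow> (inv_A \<omega> u, \<omega>)) =
        f (snd p) * indicator {p. snd p \<le> A (T (fst p)) (fst p)} p"
      using AE_A_inv
    proof (rule AE_mp, intro AE_I2 impI)
      fix p assume "p \<in> space (restrict_space (M \<Otimes>\<^sub>M lborel) range_A)"
        and eq: "A (inv_A (fst p) (snd p)) (fst p) = snd p"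
      then obtain \<omega> u where p: "p = (\<omega>, u)" and r: "(\<omega>, u) \<in> range_A"
        unfolding space_range_A by (cases p) auto
      have w: "\<omega> \<in> space M" using r by (simp add: range_A_def)
      show "H (case p of (\<omega>, u) \<Rightarrow> (inv_A \<omega> u, \<omega>)) =
        f (snd p) * indicator {p. snd p \<le> A (T (fst p)) (fst p)} p"
        using eq inv_A(1)[OF r] inv_A(3)[OF r T0[OF w]] w
        by (simp add: p H_def space_Pred indicator_def)
    qed
  qed
  also have "\<dots> = (\<integral>\<^sup>+p. f (snd p) * indicator {p. snd p \<le> A (T (fst p)) (fst p)} p * indicator range_A p
      \<partial>(M \<Otimes>\<^sub>M lborel))"
    using sets.Int[OF range_A_measurable sets.top] by (intro nn_integral_restrict_space) auto
  also have "\<dots> = (\<integral>\<^sup>+p. f (snd p) * indicator {0<..A (T (fst p)) (fst p)} (snd p) \<partial>(M \<Otimes>\<^sub>M lborel))"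
  proof (rule nn_integral_cong)
    fix p :: "'a \<times> real" assume "p \<in> space (M \<Otimes>\<^sub>M lborel)"
    then have "fst p \<in> space M" by (auto simp: space_pair_measure)
    \<comment> \<open>For a positive level below \<open>A (T \<omega>) \<omega>\<close>, the time
      \<open>T \<omega>\<close> itself witnesses membership in \<open>range_A\<close>.\<close>
    then have "snd p \<le> A (T (fst p)) (fst p) \<and> p \<in> range_A \<longleftrightarrow> snd p \<in> {0<..A (T (fst p)) (fst p)}"
      using T0 by (cases p) (auto simp: range_A_def)
    then show "f (snd p) * indicator {p. snd p \<le> A (T (fst p)) (fst p)} p * indicator range_A p =
      f (snd p) * indicator {0<..A (T (fst p)) (fst p)} (snd p)"
      by (auto simp: indicator_def)
  qed
  also have "\<dots> = (\<integral>\<^sup>+\<omega>. (\<integral>\<^sup>+u. f u * indicator {0<..A (T \<omega>) \<omega>} u \<partial>lborel) \<partial>M)"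
  proof -
    have [measurable]: "Measurable.pred (M \<Otimes>\<^sub>M (lborel :: real measure)) (\<lambda>p. snd p \<in> {0<..A (T (fst p)) (fst p)})"
      unfolding greaterThanAtMost_iff by measurable
    have "(\<lambda>p. f (snd p) * indicator {0<..A (T (fst p)) (fst p)} (snd p)) \<in> borel_measurable (M \<Otimes>\<^sub>M lborel)"
      unfolding indicator_def by measurable
    from lborel.nn_integral_fst[OF this] show ?thesis by simp
  qed
  finally show ?thesis .
qed

end

section \<open>The exponential law\<close>

lemma nn_integral_exp_truncated:
  fixes a c :: real
  assumes a: "0 \<le> a" and c: "0 \<le> c"
  shows "(\<integral>\<^sup>+u. ennreal (exp (u - c)) * indicator {..c} u * indicator {0<..a} u \<partial>lborel) =
    ennreal (exp (min a c - c) - exp (- c))"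
proof -
  have "(\<integral>\<^sup>+u. ennreal (exp (u - c)) * indicator {..c} u * indicator {0<..a} u \<partial>lborel) =
      (\<integral>\<^sup>+u. ennreal (exp (u - c)) * indicator {0..min a c} u \<partial>lborel)"
    by (rule nn_integral_cong_AE)
      (use AE_lborel_singleton[of "0::real"] in \<open>eventually_elim; auto simp: indicator_def\<close>)
  also have "\<dots> = ennreal (exp (min a c - c) - exp (0 - c))"
    by (rule nn_integral_FTC_Icc) (use a c in \<open>auto intro!: derivative_eq_intros\<close>)
  finally show ?thesis by simp
qed

context compensated_time begin

text \<open>The test function \<open>u \<mapsto> exp (u - c)\<close> on \<open>(-\<infinity>, c]\<close> is the derivative of
  \<open>F u = exp (min u c - c) - exp (- c)\<close>, and \<open>F - F'\<close> is the indicator of \<open>(c, \<infinity>)\<close> up to the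
  constant \<open>exp (- c)\<close>.\<close>

lemma prob_A_T_greater:
  assumes c: "0 \<le> c"
  shows "prob {\<omega> \<in> space M. c < A (T \<omega>) \<omega>} = exp (- c)"
proof -
  note A_T_measurable[measurable]
  have AT0: "0 \<le> A (T \<omega>) \<omega>" if "\<omega> \<in> space M" for \<omega>
    using A_mono[OF that order_refl T0[OF that]] A_zero[OF that] by simp
  define g where "g \<omega> = exp (A (T \<omega>) \<omega> - c) * indicator {..c} (A (T \<omega>) \<omega>)" for \<omega>
  define h where "h \<omega> = exp (min (A (T \<omega>) \<omega>) c - c)" for \<omega>
  have [measurable]: "g \<in> borel_measurable M" "h \<in> borel_measurable M"
    unfolding g_def h_def by measurable
  have g: "0 \<le> g \<omega>" "g \<omega> \<le> 1" for \<omega> unfolding g_def by (auto simp: indicator_def)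
  have h: "exp (- c) \<le> h \<omega>" "h \<omega> \<le> 1" if "\<omega> \<in> space M" for \<omega>
    unfolding h_def using AT0[OF that] c by auto
  have ig: "integrable M g" by (rule integrable_const_bound[of _ 1]) (use g in auto)
  have ih: "integrable M h"
  proof (rule integrable_const_bound[of _ 1])
    show "AE \<omega> in M. norm (h \<omega>) \<le> 1" by (rule AE_I2) (simp add: h_def)
  qed measurable
  have "ennreal (expectation g) = (\<integral>\<^sup>+\<omega>. ennreal (g \<omega>) \<partial>M)"
    by (rule nn_integral_eq_integral[symmetric, OF ig]) (simp add: g)
  also have "\<dots> = (\<integral>\<^sup>+\<omega>. ennreal (exp (A (T \<omega>) \<omega> - c)) * indicator {..c} (A (T \<omega>) \<omega>) \<partial>M)"
    by (rule nn_integral_cong) (auto simp: g_def indicator_def)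
  also have "\<dots> = (\<integral>\<^sup>+\<omega>. (\<integral>\<^sup>+u. ennreal (exp (u - c)) * indicator {..c} u *
      indicator {0<..A (T \<omega>) \<omega>} u \<partial>lborel) \<partial>M)"
    by (rule nn_integral_A_T) measurable
  also have "\<dots> = (\<integral>\<^sup>+\<omega>. ennreal (h \<omega> - exp (- c)) \<partial>M)"
    by (rule nn_integral_cong) (simp add: nn_integral_exp_truncated AT0 c h_def)
  also have "\<dots> = ennreal (expectation (\<lambda>\<omega>. h \<omega> - exp (- c)))"
    by (rule nn_integral_eq_integral) (use ih h in auto)
  finally have "expectation g = expectation (\<lambda>\<omega>. h \<omega> - exp (- c))"
    by (subst (asm) ennreal_inj) (auto intro!: Bochner_Integration.integral_nonneg_AE AE_I2 simp: g h)
  also have "\<dots> = expectation h - exp (- c)" using ih by (simp add: prob_space)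
  finally have 1: "expectation g = expectation h - exp (- c)" .
  \<comment> \<open>Below \<open>c\<close> the functions \<open>h\<close> and \<open>g\<close>
    agree, above it they are 1 and 0. Comparing expectations with equation \<open>1\<close> cancels
    the unknown expectation of \<open>g\<close> and leaves the tail probability.\<close>
  have "h \<omega> = g \<omega> + indicator {\<omega> \<in> space M. c < A (T \<omega>) \<omega>} \<omega>" if "\<omega> \<in> space M" for \<omega>
    using that by (auto simp: g_def h_def indicator_def min_def)
  then have "expectation h = expectation (\<lambda>\<omega>. g \<omega> + indicator {\<omega> \<in> space M. c < A (T \<omega>) \<omega>} \<omega>)"
    by (intro Bochner_Integration.integral_cong) auto
  also have "\<dots> = expectation g + prob {\<omega> \<in> space M. c < A (T \<omega>) \<omega>}"
    using ig by (subst Bochner_Integration.integral_add) (auto simp: emeasure_eq_measure)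
  finally show ?thesis using 1 by simp
qed

lemma prob_A_T_le:
  assumes c: "0 \<le> c"
  shows "prob {\<omega> \<in> space M. A (T \<omega>) \<omega> \<le> c} = 1 - exp (- c)"
proof -
  note A_T_measurable[measurable]
  have "prob {\<omega> \<in> space M. A (T \<omega>) \<omega> \<le> c} = prob (space M - {\<omega> \<in> space M. c < A (T \<omega>) \<omega>})"
    by (rule arg_cong[where f = prob]) auto
  also have "\<dots> = 1 - prob {\<omega> \<in> space M. c < A (T \<omega>) \<omega>}" by (rule prob_compl) measurable
  finally show ?thesis using prob_A_T_greater[OF c] by simp
qed

end

section \<open>From almost sure to pointwise path properties\<close>

context filtered_prob_space begin

text \<open>Allows a predictable process to be changed on a set \<open>N\<close> known at time 0,
  for all times at once, without losing predictability.\<close>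

lemma cylinder_predictable:
  assumes "N \<in> sets (F 0)"
  shows "{p \<in> space (predictable_sigma (space M) F). snd p \<in> N} \<in> sets (predictable_sigma (space M) F)"
proof -
  have "{p \<in> space (predictable_sigma (space M) F). snd p \<in> N} = {0} \<times> N \<union> {0<..} \<times> N"
    unfolding space_Pred using F_sets_into_space[OF assms] by auto
  also have "\<dots> \<in> sets (predictable_sigma (space M) F)"
    using assms by (intro sets.Un tail_predictable predictable_rects_sets predictable_rectsI) simp_all
  finally show ?thesis .
qed

lemma martingale_increment:
  assumes Y: "is_martingale M F Y" and st: "0 \<le> s" "s \<le> t" and B: "B \<in> sets (F (ennreal s))"
  shows "(\<integral>\<omega>. indicator B \<omega> * Y t \<omega> \<partial>M) = (\<integral>\<omega>. indicator B \<omega> * Y s \<omega> \<partial>M)"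
proof -
  interpret S: sigma_finite_subalgebra M "F (ennreal s)"
    by (rule finite_measure_subalgebra_is_sigma_finite, unfold_locales)
      (simp add: subalgebra_def space_F F_le)
  have t: "0 \<le> t" using st by simp
  have i: "integrable M (Y t)" and m: "Y s \<in> borel_measurable M"
    using Y st t unfolding is_martingale_def by (blast intro: measurable_F_M)+
  have BM: "B \<in> sets M" using B F_le by blast
  have "(\<integral>\<omega>. indicator B \<omega> * Y t \<omega> \<partial>M) = (\<integral>\<omega>. indicator B \<omega> * real_cond_exp M (F (ennreal s)) (Y t) \<omega> \<partial>M)"
    using S.real_cond_exp_intA[OF i B] by (simp add: set_lebesgue_integral_def)
  also have "\<dots> = (\<integral>\<omega>. indicator B \<omega> * Y s \<omega> \<partial>M)"
  proof (rule integral_cong_AE)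
    have "AE \<omega> in M. real_cond_exp M (F (ennreal s)) (Y t) \<omega> = Y s \<omega>"
      using Y st unfolding is_martingale_def by blast
    then show "AE \<omega> in M. indicator B \<omega> * real_cond_exp M (F (ennreal s)) (Y t) \<omega> = indicator B \<omega> * Y s \<omega>"
      by eventually_elim simp
  qed (intro borel_measurable_times borel_measurable_indicator BM m borel_measurable_cond_exp2)+
  finally show ?thesis .
qed

text \<open>Null sets belong to \<open>F 0\<close>, so \<open>A\<close> can be set to 0 on the
  exceptional set \<open>N\<close> and stays predictable. The integrated compensation identity
  follows from the martingale increments over \<open>B\<close>, which are unaffected by null
  sets.\<close>

lemma compensated_time_of_compensator:
  assumes null: "null_sets M \<subseteq> sets (F 0)"
    and \<tau>: "stopping_time F \<tau>" and \<tau>_pos: "AE \<omega> in M. 0 < \<tau> \<omega>" and \<tau>_fin: "AE \<omega> in M. \<tau> \<omega> < \<infinity>"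
    and A: "compensator M F \<tau> A"
    and avoid: "\<And>Y b. cont_adapted Y \<Longrightarrow> 0 \<le> b \<Longrightarrow> (\<And>\<omega>. \<omega> \<in> space M \<Longrightarrow> Y b \<omega> = 0) \<Longrightarrow>
      AE \<omega> in M. \<tau> \<omega> \<noteq> ennreal (hit Y 0 \<omega>)"
  obtains N where "N \<in> null_sets M"
    "compensated_time M F (\<lambda>\<omega>. enn2real (\<tau> \<omega>)) (\<lambda>t \<omega>. if \<omega> \<in> N then 0 else A t \<omega>)"
proof -
  let ?T = "\<lambda>\<omega>. enn2real (\<tau> \<omega>)"
  have path: "AE \<omega> in M. A 0 \<omega> = 0 \<and> mono_on {0..} (\<lambda>t. A t \<omega>) \<and>
        (\<forall>t\<ge>0. continuous (at_right t) (\<lambda>t. A t \<omega>))"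
    and pred: "(\<lambda>(t, \<omega>). A t \<omega>) \<in> borel_measurable (predictable_sigma (space M) F)"
    and mart: "is_martingale M F (\<lambda>t \<omega>. (if \<tau> \<omega> \<le> ennreal t then 1 else 0) - A t \<omega>)"
    using A unfolding compensator_def predictable_process_def by blast+
  obtain N where N: "N \<in> null_sets M" and good: "\<And>\<omega>. \<omega> \<in> space M \<Longrightarrow> \<omega> \<notin> N \<Longrightarrow>
      A 0 \<omega> = 0 \<and> mono_on {0..} (\<lambda>t. A t \<omega>) \<and> (\<forall>t\<ge>0. continuous (at_right t) (\<lambda>t. A t \<omega>))"
    using path unfolding eventually_ae_filter by blast
  have NM[measurable]: "N \<in> sets M" using N by auto
  let ?A = "\<lambda>t \<omega>. if \<omega> \<in> N then 0 else A t \<omega>"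
  have AN: "AE \<omega> in M. \<omega> \<notin> N" by (rule AE_not_in[OF N])
  have [measurable]: "\<tau> \<in> borel_measurable M"
    by (rule measurable_stopping_time[OF \<tau> F_le]) (rule space_F)
  have mA[measurable]: "A t \<in> borel_measurable M" and iA: "integrable M (A t)" if t: "0 \<le> t" for t
  proof -
    have i: "integrable M (\<lambda>\<omega>. (if \<tau> \<omega> \<le> ennreal t then 1 else 0) - A t \<omega>)"
      using mart t unfolding is_martingale_def by blast
    have j: "integrable M (\<lambda>\<omega>. (if \<tau> \<omega> \<le> ennreal t then 1 else 0::real))"
      by (rule integrable_const_bound[of _ 1]) auto
    from Bochner_Integration.integrable_diff[OF j i] show "integrable M (A t)" by simp
    then show "A t \<in> borel_measurable M" by simp
  qed
  have "compensated_time M F ?T ?A"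
  proof
    show "0 \<le> ?T \<omega>" for \<omega> by simp
    show "AE \<omega> in M. 0 < ?T \<omega>"
      using \<tau>_pos \<tau>_fin by eventually_elim (simp add: enn2real_positive_iff)
    show "{\<omega> \<in> space M. ?T \<omega> \<le> t} \<in> sets (F (ennreal t))" if t: "0 \<le> t" for t
    proof -
      have "{\<omega> \<in> space M. \<not> \<tau> \<omega> < \<infinity>} \<in> null_sets M"
      proof (rule AE_iff_null_sets[THEN iffD2])
        show "{\<omega> \<in> space M. \<not> \<tau> \<omega> < \<infinity>} \<in> sets M" by measurable
        show "AE \<omega> in M. \<omega> \<notin> {\<omega> \<in> space M. \<not> \<tau> \<omega> < \<infinity>}" using \<tau>_fin by eventually_elim simp
      qed
      then have 1: "{\<omega> \<in> space M. \<not> \<tau> \<omega> < \<infinity>} \<in> sets (F (ennreal t))"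
        using null sets_F_mono[of 0 "ennreal t"] by auto
      have 2: "{\<omega> \<in> space M. \<tau> \<omega> \<le> ennreal t} \<in> sets (F (ennreal t))"
        using stopping_timeD[OF \<tau>, of "ennreal t"] by (simp add: pred_def space_F)
      \<comment> \<open>\<open>enn2real\<close> sends infinity to 0, so the event of an infinite
        \<open>\<tau>\<close> falls into this set. It is null and hence already in the
        filtration.\<close>
      have "{\<omega> \<in> space M. ?T \<omega> \<le> t} = {\<omega> \<in> space M. \<tau> \<omega> \<le> ennreal t} \<union> {\<omega> \<in> space M. \<not> \<tau> \<omega> < \<infinity>}"
      proof (rule set_eqI)
        fix \<omega>
        show "\<omega> \<in> {\<omega> \<in> space M. ?T \<omega> \<le> t} \<longleftrightarrow>
            \<omega> \<in> {\<omega> \<in> space M. \<tau> \<omega> \<le> ennreal t} \<union> {\<omega> \<in> space M. \<not> \<tau> \<omega> < \<infinity>}"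
          using t by (cases "\<tau> \<omega>") auto
      qed
      then show ?thesis using 1 2 by simp
    qed
    show "?A 0 \<omega> = 0" if "\<omega> \<in> space M" for \<omega> using good[OF that] by simp
    show "?A s \<omega> \<le> ?A t \<omega>" if "\<omega> \<in> space M" "0 \<le> s" "s \<le> t" for \<omega> s t
      using good[OF that(1)] that(2,3) by (auto simp: mono_on_def)
    show "continuous (at_right t) (\<lambda>t. ?A t \<omega>)" if "\<omega> \<in> space M" "0 \<le> t" for \<omega> t
      using good[OF that(1)] that(2) by (cases "\<omega> \<in> N") auto
    show "?A t \<in> borel_measurable M" if "0 \<le> t" for t
      using mA[OF that] by measurable
    have "N \<in> sets (F 0)" using N null by blast
    from cylinder_predictable[OF this] pred
    have "(\<lambda>p. if snd p \<in> N then 0 else (case p of (t, \<omega>) \<Rightarrow> A t \<omega>)) \<in>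
        borel_measurable (predictable_sigma (space M) F)"
      by (intro measurable_If borel_measurable_const)
    then show "(\<lambda>(t, \<omega>). ?A t \<omega>) \<in> borel_measurable (predictable_sigma (space M) F)"
      by (simp add: split_beta' cong: if_cong)
    show "AE \<omega> in M. ?T \<omega> \<noteq> hit Y 0 \<omega>"
      if "cont_adapted Y" "0 \<le> b" "\<And>\<omega>. \<omega> \<in> space M \<Longrightarrow> Y b \<omega> = 0" for Y b
    proof -
      have "AE \<omega> in M. \<tau> \<omega> \<noteq> ennreal (hit Y 0 \<omega>)" by (rule avoid[OF that(1,2)]) (rule that(3))
      then show ?thesis using \<tau>_fin by eventually_elim (metis ennreal_enn2real infinity_ennreal_def)
    qed
    show "emeasure M (B \<inter> {\<omega> \<in> space M. s < ?T \<omega> \<and> ?T \<omega> \<le> t}) =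
        (\<integral>\<^sup>+\<omega>. ennreal (?A t \<omega> - ?A s \<omega>) * indicator B \<omega> \<partial>M)"
      if st: "0 \<le> s" "s \<le> t" and B: "B \<in> sets (F (ennreal s))" for s t B
    proof -
      have BM[measurable]: "B \<in> sets M" using B F_le by blast
      have t: "0 \<le> t" using st by simp
      let ?C = "B \<inter> {\<omega> \<in> space M. \<tau> \<omega> \<le> ennreal t} - {\<omega> \<in> space M. \<tau> \<omega> \<le> ennreal s}"
      have CM: "?C \<in> sets M" by measurable
      have iB: "integrable M (\<lambda>\<omega>. indicator B \<omega> * A r \<omega>)" if "0 \<le> r" for r
        using integrable_mult_indicator[OF BM iA[OF that]] by simp
      have iN: "integrable M (\<lambda>\<omega>. indicator B \<omega> * (if \<tau> \<omega> \<le> ennreal r then 1 else 0::real))" for r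
        by (rule integrable_const_bound[of _ 1]) (auto simp: indicator_def)
      have "(\<integral>\<omega>. indicator B \<omega> * ((if \<tau> \<omega> \<le> ennreal t then 1 else 0) - A t \<omega>) \<partial>M) =
          (\<integral>\<omega>. indicator B \<omega> * ((if \<tau> \<omega> \<le> ennreal s then 1 else 0) - A s \<omega>) \<partial>M)"
        by (rule martingale_increment[OF mart st B])
      then have "(\<integral>\<omega>. indicator B \<omega> * (if \<tau> \<omega> \<le> ennreal t then 1 else 0) \<partial>M) -
          (\<integral>\<omega>. indicator B \<omega> * (if \<tau> \<omega> \<le> ennreal s then 1 else 0) \<partial>M) =
          (\<integral>\<omega>. indicator B \<omega> * A t \<omega> \<partial>M) - (\<integral>\<omega>. indicator B \<omega> * A s \<omega> \<partial>M)"
        using iB[OF st(1)] iB[OF t] iN by (simp add: right_diff_distrib)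
      then have eq: "(\<integral>\<omega>. indicator B \<omega> * (if \<tau> \<omega> \<le> ennreal t then 1 else 0) -
          indicator B \<omega> * (if \<tau> \<omega> \<le> ennreal s then 1 else 0) \<partial>M) =
          (\<integral>\<omega>. indicator B \<omega> * A t \<omega> - indicator B \<omega> * A s \<omega> \<partial>M)"
        using iB[OF st(1)] iB[OF t] iN by simp
      have "emeasure M (B \<inter> {\<omega> \<in> space M. s < ?T \<omega> \<and> ?T \<omega> \<le> t}) = emeasure M ?C"
      proof (rule emeasure_eq_AE)
        show "AE \<omega> in M. \<omega> \<in> B \<inter> {\<omega> \<in> space M. s < ?T \<omega> \<and> ?T \<omega> \<le> t} \<longleftrightarrow> \<omega> \<in> ?C"
          using \<tau>_fin
        proof eventually_elim
          case (elim \<omega>)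
          then show ?case using st t by (cases "\<tau> \<omega>") (auto simp: not_le)
        qed
        show "B \<inter> {\<omega> \<in> space M. s < ?T \<omega> \<and> ?T \<omega> \<le> t} \<in> sets M" by measurable
      qed (rule CM)
      also have "\<dots> = ennreal (\<integral>\<omega>. indicator ?C \<omega> \<partial>M)"
        using CM by (simp add: emeasure_eq_measure)
      also have "(\<integral>\<omega>. indicat_real ?C \<omega> \<partial>M) = (\<integral>\<omega>. indicator B \<omega> * (if \<tau> \<omega> \<le> ennreal t then 1 else 0) -
          indicator B \<omega> * (if \<tau> \<omega> \<le> ennreal s then 1 else 0) \<partial>M)"
        using order_trans[OF _ ennreal_leI[OF st(2)]]
        by (intro Bochner_Integration.integral_cong) (auto simp: indicator_def)
      also have "\<dots> = (\<integral>\<omega>. indicator B \<omega> * A t \<omega> - indicator B \<omega> * A s \<omega> \<partial>M)" by (rule eq)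
      also have "ennreal \<dots> = (\<integral>\<^sup>+\<omega>. ennreal (indicator B \<omega> * A t \<omega> - indicator B \<omega> * A s \<omega>) \<partial>M)"
      proof (rule nn_integral_eq_integral[symmetric])
        show "integrable M (\<lambda>\<omega>. indicator B \<omega> * A t \<omega> - indicator B \<omega> * A s \<omega>)"
          using iB[OF st(1)] iB[OF t] by simp
        show "AE \<omega> in M. 0 \<le> indicator B \<omega> * A t \<omega> - indicator B \<omega> * A s \<omega>"
          using path by eventually_elim (use st in \<open>auto simp: indicator_def mono_on_def\<close>)
      qed
      also have "\<dots> = (\<integral>\<^sup>+\<omega>. ennreal (?A t \<omega> - ?A s \<omega>) * indicator B \<omega> \<partial>M)"
        by (rule nn_integral_cong_AE)
          (use AN in \<open>eventually_elim; auto simp: indicator_def\<close>)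
      finally show ?thesis .
    qed
  qed
  with N show ?thesis by (rule that)
qed

end

lemma null_sets_completed_filtration:
  "null_sets (completion M) \<subseteq> sets (completed_filtration M X t)"
  unfolding completed_filtration_def sets_measure_of[OF completed_filtration_gen_Pow]
  by (blast intro: sigma_sets.Basic)

theorem theorem2:
  fixes P :: "real \<Rightarrow> 'a measure" and X :: "real \<Rightarrow> 'a \<Rightarrow> real" and x :: real
    and \<tau> :: "'a \<Rightarrow> ennreal" and A :: "real \<Rightarrow> 'a \<Rightarrow> real"
  assumes "strong_markov_process P X"
    and "feller_process P X"
    and "\<And>\<omega>. \<omega> \<in> space (P x) \<Longrightarrow> cadlag (\<lambda>t. X t \<omega>)"
    and "jump_time (completion (P x)) (completed_filtration (P x) X) X \<tau>"
    and "AE \<omega> in completion (P x). \<tau> \<omega> < \<infinity>"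
    and "compensator (completion (P x)) (completed_filtration (P x) X) \<tau> A"
  shows "distributed (completion (P x)) lborel (\<lambda>\<omega>. A (enn2real (\<tau> \<omega>)) \<omega>) (exponential_density 1)
    \<and> (\<forall>t\<ge>0. measure (completion (P x))
          {\<omega> \<in> space (P x). A (enn2real (\<tau> \<omega>)) \<omega> \<le> t} = 1 - exp (- t))"
proof -
  interpret strong_feller_process P X x
    by (intro strong_feller_process.intro strong_feller_process_axioms.intro assms(1-3))
  let ?T = "\<lambda>\<omega>. enn2real (\<tau> \<omega>)"
  obtain N where N: "N \<in> null_sets Px"
    and ct: "compensated_time Px Fx ?T (\<lambda>t \<omega>. if \<omega> \<in> N then 0 else A t \<omega>)"
  proof (rule compensated_time_of_compensator[OF null_sets_completed_filtration _ _ assms(5,6)])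
    show "stopping_time Fx \<tau>" "AE \<omega> in Px. 0 < \<tau> \<omega>"
      using assms(4) unfolding jump_time_def by blast+
    show "AE \<omega> in Px. \<tau> \<omega> \<noteq> ennreal (hit Y 0 \<omega>)"
      if "cont_adapted Y" "0 \<le> b" "\<And>\<omega>. \<omega> \<in> space Px \<Longrightarrow> Y b \<omega> = 0" for Y b
      by (rule jump_time_neq_hit[OF that(1,2) _ assms(4)]) (rule that(3))
  qed blast
  interpret C: compensated_time Px Fx ?T "\<lambda>t \<omega>. if \<omega> \<in> N then 0 else A t \<omega>" by (rule ct)
  have "(\<lambda>(t, \<omega>). A t \<omega>) \<in> borel_measurable C.Pred"
    using assms(6) unfolding compensator_def predictable_process_def by blast
  from measurable_compose[OF C.graph_measurable this]
  have m: "(\<lambda>\<omega>. A (?T \<omega>) \<omega>) \<in> borel_measurable Px" by simp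
  \<comment> \<open>Return from the modified process to \<open>A\<close>: for almost every sample
    point they coincide at all times, in particular at the random time \<open>?T\<close>.\<close>
  have p: "prob {\<omega> \<in> space Px. A (?T \<omega>) \<omega> \<le> c} = 1 - exp (- c)" if c: "0 \<le> c" for c
  proof -
    have "prob {\<omega> \<in> space Px. A (?T \<omega>) \<omega> \<le> c} =
        prob {\<omega> \<in> space Px. (if \<omega> \<in> N then 0 else A (?T \<omega>) \<omega>) \<le> c}"
    proof (rule finite_measure_eq_AE)
      show "AE \<omega> in Px. \<omega> \<in> {\<omega> \<in> space Px. A (?T \<omega>) \<omega> \<le> c} \<longleftrightarrow>
          \<omega> \<in> {\<omega> \<in> space Px. (if \<omega> \<in> N then 0 else A (?T \<omega>) \<omega>) \<le> c}"
        using AE_not_in[OF N] by eventually_elim simp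
      show "{\<omega> \<in> space Px. A (?T \<omega>) \<omega> \<le> c} \<in> events"
        using m by measurable
      show "{\<omega> \<in> space Px. (if \<omega> \<in> N then 0 else A (?T \<omega>) \<omega>) \<le> c} \<in> events"
        using C.A_T_measurable by measurable
    qed
    then show ?thesis using C.prob_A_T_le[OF c] by simp
  qed
  have "distributed Px lborel (\<lambda>\<omega>. A (?T \<omega>) \<omega>) (exponential_density 1)"
  proof (rule exponential_distributedI[OF m zero_less_one])
    fix a :: real assume a: "0 \<le> a"
    show "emeasure Px {\<omega> \<in> space Px. A (?T \<omega>) \<omega> \<le> a} = 1 - ennreal (exp (- a * 1))"
      unfolding emeasure_eq_measure p[OF a] by (simp add: ennreal_minus ennreal_1[symmetric] del: ennreal_1)
  qed
  then show ?thesis using p by simp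
qed

end
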